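(* The decision problem ARRIVAL is in $\mathrm{NP}$.
   Context: A switch graph is a 4-tuple $G=(V,E,s_0,s_1)$ where $V$ is a finite vertex set, $n=|V|$, $s_0,s_1:V\to V$, and $E=\{(v,s_0(v)):v\in V\}\cup\{(v,s_1(v)):v\in V\}$ (loops allowed; possibly $s_0(v)=s_1(v)$). The procedure $\textsc{Run}(G,o,d)$: maintain arrays $\mathtt{s\_curr},\mathtt{s\_next}$ indexed by $V$, initially $\mathtt{s\_curr}[v]=s_0(v)$, $\mathtt{s\_next}[v]=s_1(v)$; set $v:=o$; while $v\neq d$: $w:=\mathtt{s\_curr}[v]$, swap $\mathtt{s\_curr}[v],\mathtt{s\_next}[v]$, $v:=w$ (traversing edge $(v,w)$). ARRIVAL is the decision problem: given a switch graph $G$ (encoded by the maps $s_0,s_1$) and $o,d\in V$, does $\textsc{Run}(G,o,d)$ terminate? *)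

theory Defs
  imports Main
begin

text \<open>A switch graph with vertex set V = {0..<n} is given by two lists s0, s1 of
  length n with entries < n (the maps s_0, s_1).  An ARRIVAL instance additionally
  has an origin orig < n and a destination d < n.\<close>

definition valid_instance :: "nat \<Rightarrow> nat list \<Rightarrow> nat list \<Rightarrow> nat \<Rightarrow> nat \<Rightarrow> bool" where
  "valid_instance n s0 s1 orig d \<longleftrightarrow>
     length s0 = n \<and> length s1 = n \<and> (\<forall>v<n. s0 ! v < n \<and> s1 ! v < n) \<and> orig < n \<and> d < n"

definition run_step :: "nat \<times> (nat \<Rightarrow> nat) \<times> (nat \<Rightarrow> nat) \<Rightarrow> nat \<times> (nat \<Rightarrow> nat) \<times> (nat \<Rightarrow> nat)" where
  "run_step st = (case st of (v, scurr, snext) \<Rightarrow>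
      (scurr v, scurr(v := snext v), snext(v := scurr v)))"

definition run_init :: "nat list \<Rightarrow> nat list \<Rightarrow> nat \<Rightarrow> nat \<times> (nat \<Rightarrow> nat) \<times> (nat \<Rightarrow> nat)" where
  "run_init s0 s1 orig = (orig, (\<lambda>v. s0 ! v), (\<lambda>v. s1 ! v))"

text \<open>Run(G,orig,d) terminates iff the current vertex equals d after some number of
  loop iterations (the loop stops at the first such time).\<close>

definition run_terminates :: "nat list \<Rightarrow> nat list \<Rightarrow> nat \<Rightarrow> nat \<Rightarrow> bool" where
  "run_terminates s0 s1 orig d \<longleftrightarrow> (\<exists>k. fst ((run_step ^^ k) (run_init s0 s1 orig)) = d)"

fun bin :: "nat \<Rightarrow> bool list" where
  "bin m = (if m = 0 then [] else odd m # bin (m div 2))"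

text \<open>Self-delimiting binary code: each bit doubled, terminated by the pair False,True.\<close>
definition enc_num :: "nat \<Rightarrow> bool list" where
  "enc_num m = concat (map (\<lambda>b. [b, b]) (bin m)) @ [False, True]"

definition enc_instance :: "nat \<Rightarrow> nat list \<Rightarrow> nat list \<Rightarrow> nat \<Rightarrow> nat \<Rightarrow> bool list" where
  "enc_instance n s0 s1 orig d = concat (map enc_num ([n, orig, d] @ s0 @ s1))"

definition ARRIVAL :: "bool list set" where
  "ARRIVAL = {enc_instance n s0 s1 orig d | n s0 s1 orig d.
                 valid_instance n s0 s1 orig d \<and> run_terminates s0 s1 orig d}"

text \<open>A TM is (Q, K, delta): states 0..<Q (0 start, 1 accept, 2 reject), tape symbols
  0..<K (0 blank, 1 and 2 encode the bits False/True, 3 a separator), and a transition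
  function delta q a = (q', a', move) with move in {-1,0,1}.\<close>

type_synonym tm = "nat \<times> nat \<times> (nat \<Rightarrow> nat \<Rightarrow> nat \<times> nat \<times> int)"
type_synonym tm_config = "nat \<times> (int \<Rightarrow> nat) \<times> int"

definition wf_tm :: "tm \<Rightarrow> bool" where
  "wf_tm M = (case M of (Q, K, \<delta>) \<Rightarrow> 3 \<le> Q \<and> 4 \<le> K \<and>
      (\<forall>q<Q. \<forall>a<K. fst (\<delta> q a) < Q \<and> fst (snd (\<delta> q a)) < K \<and> snd (snd (\<delta> q a)) \<in> {-1, 0, 1}))"

definition tm_step :: "tm \<Rightarrow> tm_config \<Rightarrow> tm_config" where
  "tm_step M c = (case M of (Q, K, \<delta>) \<Rightarrow> (case c of (q, tape, h) \<Rightarrow>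
      (if q = 1 \<or> q = 2 then (q, tape, h)
       else (case \<delta> q (tape h) of (q', a', m) \<Rightarrow> (q', tape(h := a'), h + m)))))"

definition tm_init :: "nat list \<Rightarrow> tm_config" where
  "tm_init w = (0, (\<lambda>i. if 0 \<le> i \<and> i < int (length w) then w ! nat i else 0), 0)"

definition accepts_within :: "tm \<Rightarrow> nat list \<Rightarrow> nat \<Rightarrow> bool" where
  "accepts_within M w t \<longleftrightarrow> (\<exists>i\<le>t. fst ((tm_step M ^^ i) (tm_init w)) = 1)"

definition sym :: "bool \<Rightarrow> nat" where
  "sym b = (if b then 2 else 1)"

definition verifier_input :: "bool list \<Rightarrow> bool list \<Rightarrow> nat list" where
  "verifier_input x y = map sym x @ [3] @ map sym y"

definition in_NP :: "bool list set \<Rightarrow> bool" where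
  "in_NP L \<longleftrightarrow> (\<exists>M c k. wf_tm M \<and>
     (\<forall>x. x \<in> L \<longleftrightarrow> (\<exists>y. length y \<le> c * length x ^ k + c \<and>
            accepts_within M (verifier_input x y) (c * length x ^ k + c))))"

end

theory Submission
  imports Defs "HOL-Library.Nat_Bijection"
begin

text \<open>If t v is the number of times Run leaves v, then t satisfies a conservation law: the
  alternation of the switches sends the ceiling of t v / 2 tokens along the s_0-edge of v and the
  floor along its s_1-edge. Conversely any solution t of this law (away from d) dominates the visit
  counts of an unfinished run, so the run must reach d. As Run repeats no configuration before
  reaching d, some solution has entries below n * 2^n, hence of polynomial bit length.

  A certificate consists of the bit tables of five ternary relations on {0..<m}, with m the input
  length: a parse of the input, the decoded numbers, the bits of t, the partial sums of the inflows
  and the carries of these additions. All conditions on these tables are local, so they form a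
  first-order sentence over the word whose quantifiers range over positions and whose atoms are
  letters and position arithmetic. Such sentences are decided in polynomial time by a Turing machine
  that keeps the values of the variables as marks on its tape.\<close>

section \<open>Structured programs on a marked tape\<close>

text \<open>A run can have exponential length, so only departure counts in binary can be guessed.
  The conservation law exempts \<open>d\<close> because the token ends there and does not leave
  again. The verifier must also refuse, under every certificate, words that encode no instance;
  hence the certificate has to justify the decoding as well. Whatever a formula mentions must be a
  position. Each of the 2 * n + 3 numbers of an instance takes at least two letters, so 4 * n + 6
  \<le> m, and vertices, edge numbers and bit indices all lie below m. The counts are too large for
  this and appear only bit by bit. Since n * 2^n < 2^(m - 1), counts and partial sums fit into m - 1
  bits; demanding that the top bit and the last carry vanish makes every bitwise addition exact.
  Formulas have no syntax here: \<open>dec\<close> is a property of predicates, closed under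
  connectives, bounded quantifiers and arithmetic, and the evaluating program is assembled by the
  closure proofs themselves.\<close>

text \<open>A tape cell carries an input letter, which is never overwritten, and a set of marks.\<close>

type_synonym cell = "nat \<times> nat set"

datatype cmd = MoveL | MoveR | Put nat | Del nat | Seq cmd cmd
  | Cond "cell \<Rightarrow> bool" cmd cmd | While "cell \<Rightarrow> bool" cmd

fun act :: "cmd list \<Rightarrow> cell \<Rightarrow> cmd list \<times> cell \<times> int" where
  "act [] a = ([], a, 0)"
| "act (MoveL # ks) a = (ks, a, -1)"
| "act (MoveR # ks) a = (ks, a, 1)"
| "act (Put v # ks) a = (ks, (fst a, insert v (snd a)), 0)"
| "act (Del v # ks) a = (ks, (fst a, snd a - {v}), 0)"
| "act (Seq c d # ks) a = (c # d # ks, a, 0)"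
| "act (Cond b c d # ks) a = ((if b a then c else d) # ks, a, 0)"
| "act (While b c # ks) a = (if b a then c # While b c # ks else ks, a, 0)"

definition step :: "cmd list \<times> (int \<Rightarrow> cell) \<times> int \<Rightarrow> cmd list \<times> (int \<Rightarrow> cell) \<times> int" where
  "step = (\<lambda>(ks, T, h). case act ks (T h) of (ks', a, m) \<Rightarrow> (ks', T(h := a), h + m))"

definition tape :: "nat list \<Rightarrow> (nat \<Rightarrow> int option) \<Rightarrow> int \<Rightarrow> cell" where
  "tape w E i = (if 0 \<le> i \<and> i < int (length w) then w ! nat i else 0, {v. E v = Some i})"

text \<open>The environment E places each mark on at most one cell; t is only an upper bound on the number
  of steps, and the stack below the command is arbitrary.\<close>

definition exec ::
  "nat list \<Rightarrow> cmd \<Rightarrow> nat \<Rightarrow> (nat \<Rightarrow> int option) \<Rightarrow> int \<Rightarrow> (nat \<Rightarrow> int option) \<Rightarrow> int \<Rightarrow> bool" where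
  "exec w c t E h E' h' \<longleftrightarrow>
     (\<exists>t'\<le>t. \<forall>ks. (step ^^ t') (c # ks, tape w E, h) = (ks, tape w E', h'))"

lemma exec_mono: "exec w c t E h E' h' \<Longrightarrow> t \<le> t' \<Longrightarrow> exec w c t' E h E' h'"
  unfolding exec_def by (meson le_trans)

lemma exec_one:
  assumes "\<And>ks. step (c # ks, tape w E, h) = (ks, tape w E', h')"
  shows "exec w c 1 E h E' h'"
  unfolding exec_def by (rule exI[of _ 1]) (simp add: assms)

lemma exec_MoveL: "exec w MoveL 1 E h E (h - 1)"
  by (rule exec_one) (simp add: step_def)

lemma exec_MoveR: "exec w MoveR 1 E h E (h + 1)"
  by (rule exec_one) (simp add: step_def)

lemma exec_MoveR_Suc: "exec w MoveR (Suc 0) E (int i) E (int (Suc i))"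
  using exec_MoveR[of w E "int i"] by (simp add: add.commute)

lemma exec_Put: "E v = None \<Longrightarrow> exec w (Put v) 1 E h (E(v \<mapsto> h)) h"
  by (rule exec_one) (auto simp: step_def tape_def fun_eq_iff)

lemma exec_Del: "E v = Some h \<Longrightarrow> exec w (Del v) 1 E h (E(v := None)) h"
  by (rule exec_one) (auto simp: step_def tape_def fun_eq_iff)

lemma exec_Seq:
  assumes "exec w c t1 E h E1 h1" "exec w d t2 E1 h1 E2 h2"
  shows "exec w (Seq c d) (t1 + t2 + 1) E h E2 h2"
proof -
  obtain u1 u2 where u: "u1 \<le> t1" "u2 \<le> t2"
    "\<And>ks. (step ^^ u1) (c # ks, tape w E, h) = (ks, tape w E1, h1)"
    "\<And>ks. (step ^^ u2) (d # ks, tape w E1, h1) = (ks, tape w E2, h2)"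
    using assms unfolding exec_def by auto
  have "step (Seq c d # ks, tape w E, h) = (c # d # ks, tape w E, h)" for ks
    by (simp add: step_def)
  then have "(step ^^ Suc (u2 + u1)) (Seq c d # ks, tape w E, h) = (ks, tape w E2, h2)" for ks
    by (simp add: funpow_Suc_right funpow_add u del: funpow.simps)
  then show ?thesis unfolding exec_def using u(1,2)
    by (intro exI[of _ "Suc (u2 + u1)"]) auto
qed

lemma exec_pre:
  assumes "\<And>ks. step (c # ks, tape w E, h) = (d # ks, tape w E, h)"
    and "exec w d t E h E' h'"
  shows "exec w c (t + 1) E h E' h'"
proof -
  obtain u where u: "u \<le> t" "\<And>ks. (step ^^ u) (d # ks, tape w E, h) = (ks, tape w E', h')"
    using assms(2) unfolding exec_def by auto
  show ?thesis unfolding exec_def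
    by (rule exI[of _ "Suc u"]) (use u in \<open>simp add: funpow_Suc_right assms(1) del: funpow.simps\<close>)
qed

lemma exec_Cond:
  assumes "exec w (if b (tape w E h) then c else d) t E h E' h'"
  shows "exec w (Cond b c d) (t + 1) E h E' h'"
  by (rule exec_pre[OF _ assms]) (simp add: step_def)

lemma exec_While_stop:
  assumes "\<not> b (tape w E h)"
  shows "exec w (While b c) 1 E h E h"
  by (rule exec_one) (simp add: step_def assms)

lemma exec_While_step:
  assumes "b (tape w E h)" "exec w c t E h E1 h1" "exec w (While b c) t' E1 h1 E' h'"
  shows "exec w (While b c) (t + t' + 1) E h E' h'"
proof -
  obtain u1 u2 where u: "u1 \<le> t" "u2 \<le> t'"
    "\<And>ks. (step ^^ u1) (c # ks, tape w E, h) = (ks, tape w E1, h1)"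
    "\<And>ks. (step ^^ u2) (While b c # ks, tape w E1, h1) = (ks, tape w E', h')"
    using assms unfolding exec_def by auto
  have "step (While b c # ks, tape w E, h) = (c # While b c # ks, tape w E, h)" for ks
    by (simp add: step_def assms(1))
  then have "(step ^^ Suc (u2 + u1)) (While b c # ks, tape w E, h) = (ks, tape w E', h')" for ks
    by (simp add: funpow_Suc_right funpow_add u del: funpow.simps)
  then show ?thesis unfolding exec_def using u(1,2)
    by (intro exI[of _ "Suc (u2 + u1)"]) auto
qed

text \<open>Giving the environment \<open>F i\<close> and the head position \<open>p i\<close> after
  each round replaces a loop invariant and a termination measure; every loop with a known number of
  rounds is an instance.\<close>

lemma exec_For:
  assumes "\<And>i. i < n \<Longrightarrow> b (tape w (F i) (p i))"
    and "\<And>i. i < n \<Longrightarrow> exec w c t (F i) (p i) (F (Suc i)) (p (Suc i))"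
    and "\<not> b (tape w (F n) (p n))"
  shows "exec w (While b c) (n * (t + 1) + 1) (F 0) (p 0) (F n) (p n)"
  using assms
proof (induction n arbitrary: F p)
  case 0
  then show ?case using exec_While_stop by simp
next
  case (Suc n)
  have "exec w (While b c) (n * (t + 1) + 1) (F (Suc 0)) (p (Suc 0)) (F (Suc n)) (p (Suc n))"
    by (rule Suc.IH) (use Suc.prems in auto)
  from exec_While_step[OF _ _ this] Suc.prems(1)[of 0] Suc.prems(2)[of 0]
  have "exec w (While b c) (t + (n * (t + 1) + 1) + 1) (F 0) (p 0) (F (Suc n)) (p (Suc n))"
    by blast
  then show ?case by (rule exec_mono) simp
qed

text \<open>Even an idle command has to remove itself from the stack; a loop whose guard never holds
  does this in one step.\<close>

definition skip :: cmd where "skip = While (\<lambda>_. False) MoveL"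

lemma exec_skip: "exec w skip 1 E h E h"
  unfolding skip_def by (rule exec_While_stop) simp

definition goto :: "nat \<Rightarrow> cmd" where "goto v = While (\<lambda>(a, S). v \<notin> S) MoveR"

definition home :: cmd where "home = Seq (While (\<lambda>(a, S). a \<noteq> 0) MoveL) MoveR"

text \<open>Letter 0 is the blank, so a word without it has recognisable ends: \<open>home\<close>
  finds cell 0 by overshooting to the blank on its left, and a search notices the blank behind the
  last letter.\<close>

definition word :: "nat list \<Rightarrow> bool" where "word w \<longleftrightarrow> w \<noteq> [] \<and> 0 \<notin> set w"

lemma exec_goto:
  assumes "E v = Some (int p)" "p < length w"
  shows "exec w (goto v) (2 * length w + 5) E 0 E (int p)"
proof -
  have "exec w (goto v) (p * (1 + 1) + 1) E (int 0) E (int p)"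
    unfolding goto_def
    by (rule exec_For[where F = "\<lambda>_. E" and p = int])
      (use assms exec_MoveR_Suc in \<open>auto simp: tape_def simp del: of_nat_Suc\<close>)
  from exec_mono[OF this[unfolded of_nat_0]] show ?thesis using assms by simp
qed

lemma exec_home:
  assumes "word w" "p < length w"
  shows "exec w home (2 * length w + 5) E (int p) E 0"
proof -
  have nz: "w ! q \<noteq> 0" if "q < length w" for q
    using assms(1) that unfolding word_def by (metis nth_mem)
  have st: "exec w MoveL 1 E (int p - int i) E (int p - int (Suc i))" for i
  proof -
    have "int p - int (Suc i) = int p - int i - 1" by simp
    then show ?thesis using exec_MoveL by metis
  qed
  have "exec w (While (\<lambda>(a, S). a \<noteq> 0) MoveL) (Suc p * (1 + 1) + 1) E (int p - int 0) E (int p - int (Suc p))"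
    by (rule exec_For[where F = "\<lambda>_. E" and p = "\<lambda>i. int p - int i"])
      (use st nz assms in \<open>auto simp: tape_def\<close>)
  moreover have "int p - int 0 = int p" "int p - int (Suc p) = - 1" by auto
  ultimately have "exec w (While (\<lambda>(a, S). a \<noteq> 0) MoveL) (Suc p * (1 + 1) + 1) E (int p) E (- 1)"
    by metis
  from exec_Seq[OF this exec_MoveR]
  have "exec w home (Suc p * (1 + 1) + 1 + 1 + 1) E (int p) E 0" by (simp add: home_def)
  then show ?thesis by (rule exec_mono) (use assms in auto)
qed

section \<open>Predicates decidable in polynomial time\<close>

text \<open>The base \<open>n + 2\<close> is at least 2 for every \<open>n\<close>, so constants and
  sums are absorbed by raising the exponent, and one parameter describes a polynomial bound.\<close>

definition pbound :: "(nat \<Rightarrow> nat) \<Rightarrow> bool" where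
  "pbound f \<longleftrightarrow> (\<exists>b. \<forall>n. f n \<le> (n + 2) ^ b)"

lemma pbound_const: "pbound (\<lambda>n. a)"
proof -
  have "a \<le> (n + 2) ^ a" for n :: nat
  proof -
    have "a \<le> 2 ^ a" by (simp add: less_imp_le)
    also have "\<dots> \<le> (n + 2) ^ a" by (rule power_mono) auto
    finally show ?thesis .
  qed
  then show ?thesis unfolding pbound_def by blast
qed

lemma pbound_id: "pbound (\<lambda>n. n)"
  unfolding pbound_def by (rule exI[of _ 1]) simp

lemma pbound_mult:
  assumes "pbound f" "pbound g"
  shows "pbound (\<lambda>n. f n * g n)"
proof -
  obtain a b where "\<And>n. f n \<le> (n + 2) ^ a" "\<And>n. g n \<le> (n + 2) ^ b"
    using assms unfolding pbound_def by auto
  then have "f n * g n \<le> (n + 2) ^ (a + b)" for n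
    by (simp only: power_add mult_le_mono)
  then show ?thesis unfolding pbound_def by blast
qed

lemma pbound_add:
  assumes "pbound f" "pbound g"
  shows "pbound (\<lambda>n. f n + g n)"
proof -
  obtain a b where ab: "\<And>n. f n \<le> (n + 2) ^ a" "\<And>n. g n \<le> (n + 2) ^ b"
    using assms unfolding pbound_def by auto
  have "f n + g n \<le> (n + 2) ^ (a + b + 1)" for n
  proof -
    have "f n \<le> (n + 2) ^ (a + b)" "g n \<le> (n + 2) ^ (a + b)"
      using ab[of n] by (auto intro: order_trans power_increasing)
    then have "f n + g n \<le> 2 * (n + 2) ^ (a + b)" by simp
    also have "\<dots> \<le> (n + 2) * (n + 2) ^ (a + b)" by (rule mult_le_mono1) simp
    finally show ?thesis by simp
  qed
  then show ?thesis unfolding pbound_def by blast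
qed

lemmas pbound_intros = pbound_add pbound_mult pbound_const pbound_id

text \<open>Variable i is represented by mark i + 2. Mark 0, placed on cell 0, is the truth value returned
  by a program; mark 1 signals that a search has failed.\<close>

definition env :: "nat \<Rightarrow> (nat \<Rightarrow> nat) \<Rightarrow> nat \<Rightarrow> int option" where
  "env k \<rho> v = (if 2 \<le> v \<and> v < k + 2 then Some (int (\<rho> (v - 2))) else None)"

definition valid :: "nat list \<Rightarrow> nat \<Rightarrow> (nat \<Rightarrow> nat) \<Rightarrow> bool" where
  "valid w k \<rho> \<longleftrightarrow> word w \<and> (\<forall>i<k. \<rho> i < length w)"

definition flag :: "bool \<Rightarrow> (nat \<Rightarrow> int option) \<Rightarrow> nat \<Rightarrow> int option" where
  "flag b E = (if b then E(0 \<mapsto> 0) else E)"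

text \<open>One program must serve all words and assignments. It starts and ends on cell 0 and
  leaves the variable marks as they were, so that programs for subformulas can be composed and rerun
  inside a search.\<close>

definition dec :: "nat \<Rightarrow> (nat list \<Rightarrow> (nat \<Rightarrow> nat) \<Rightarrow> bool) \<Rightarrow> bool" where
  "dec k P \<longleftrightarrow> (\<exists>c f. pbound f \<and> (\<forall>w \<rho>. valid w k \<rho> \<longrightarrow>
      exec w c (f (length w)) (env k \<rho>) 0 (flag (P w \<rho>) (env k \<rho>)) 0))"

lemma decI:
  assumes "pbound f"
    and "\<And>w \<rho>. valid w k \<rho> \<Longrightarrow>
      exec w c (f (length w)) (env k \<rho>) 0 (flag (P w \<rho>) (env k \<rho>)) 0"
  shows "dec k P"
  using assms unfolding dec_def by blast

lemma env_simps [simp]: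
  "env k \<rho> 0 = None" "env k \<rho> (Suc 0) = None" "env k \<rho> (k + 2) = None" "env k \<rho> (Suc (Suc k)) = None"
  "i < k \<Longrightarrow> env k \<rho> (Suc (Suc i)) = Some (int (\<rho> i))"
  by (auto simp: env_def)

lemma env_Suc: "env (Suc k) (\<rho>(k := i)) = (env k \<rho>)(k + 2 \<mapsto> int i)"
  by (auto simp: env_def fun_eq_iff)

lemma valid_Suc: "valid w k \<rho> \<Longrightarrow> i < length w \<Longrightarrow> valid w (Suc k) (\<rho>(k := i))"
  by (auto simp: valid_def less_Suc_eq)

lemma valid_pos: "valid w k \<rho> \<Longrightarrow> 0 < length w"
  by (auto simp: valid_def word_def)

lemma dec_cong:
  assumes "dec k P" "\<And>w \<rho>. valid w k \<rho> \<Longrightarrow> P w \<rho> = Q w \<rho>"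
  shows "dec k Q"
proof -
  obtain c f where "pbound f" "\<And>w \<rho>. valid w k \<rho> \<Longrightarrow>
      exec w c (f (length w)) (env k \<rho>) 0 (flag (P w \<rho>) (env k \<rho>)) 0"
    using assms(1) unfolding dec_def by blast
  with assms(2) show ?thesis by (intro decI[where c = c and f = f]) auto
qed

lemma exec_ret:
  assumes "word w" "p < length w" "E 0 = None"
  shows "exec w (if b then Seq home (Put 0) else home) (2 * length w + 7) E (int p) (flag b E) 0"
proof (cases b)
  case True
  from exec_Seq[OF exec_home[OF assms(1,2)] exec_Put[of E 0]] assms(3) True
  show ?thesis by (simp add: flag_def numeral_eq_Suc)
next
  case False
  then show ?thesis using exec_mono[OF exec_home[OF assms(1,2)]] by (simp add: flag_def)
qed

section \<open>Atoms, connectives and the existential quantifier\<close>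

lemma dec_sym:
  assumes "i < k"
  shows "dec k (\<lambda>w \<rho>. w ! \<rho> i = a)"
proof (rule decI)
  let ?f = "\<lambda>n. (2 * n + 5) + ((2 * n + 7) + 1) + 1 :: nat"
  show "pbound ?f" by (intro pbound_intros)
  fix w \<rho>
  assume v: "valid w k \<rho>"
  have p: "\<rho> i < length w" using v assms by (auto simp: valid_def)
  have "exec w (Cond (\<lambda>(b, S). b = a) (Seq home (Put 0)) home) (2 * length w + 7 + 1)
     (env k \<rho>) (int (\<rho> i)) (flag (w ! \<rho> i = a) (env k \<rho>)) 0"
    by (rule exec_Cond)
      (use exec_ret[of w "\<rho> i" "env k \<rho>" "w ! \<rho> i = a"] p v in \<open>auto simp: valid_def tape_def\<close>)
  from exec_Seq[OF exec_goto this, of "Suc (Suc i)"] p assms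
  show "exec w (Seq (goto (Suc (Suc i))) (Cond (\<lambda>(b, S). b = a) (Seq home (Put 0)) home))
      (?f (length w)) (env k \<rho>) 0 (flag (w ! \<rho> i = a) (env k \<rho>)) 0"
    by simp
qed

text \<open>Walking right from cell 0 to the first of the two marks, it suffices to see whether the
  mark of \<open>j\<close> is absent there; this also answers correctly when both marks share a
  cell.\<close>

lemma dec_less:
  assumes "i < k" "j < k"
  shows "dec k (\<lambda>w \<rho>. \<rho> i < \<rho> j)"
proof (rule decI)
  let ?f = "\<lambda>n. (n * 2 + 1) + ((2 * n + 7) + 1) + 1 :: nat"
  let ?i = "Suc (Suc i)" and ?j = "Suc (Suc j)"
  show "pbound ?f" by (intro pbound_intros)
  fix w \<rho>
  assume v: "valid w k \<rho>"
  define p where "p = min (\<rho> i) (\<rho> j)"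
  have p: "p < length w" using v assms by (auto simp: valid_def p_def)
  have "exec w (While (\<lambda>(b, S). ?i \<notin> S \<and> ?j \<notin> S) MoveR) (p * (1 + 1) + 1)
      (env k \<rho>) (int 0) (env k \<rho>) (int p)"
    by (rule exec_For[where F = "\<lambda>_. env k \<rho>" and p = int])
      (use assms exec_MoveR_Suc in \<open>auto simp: tape_def p_def simp del: of_nat_Suc\<close>)
  from exec_mono[OF this[unfolded of_nat_0]] p
  have 1: "exec w (While (\<lambda>(b, S). ?i \<notin> S \<and> ?j \<notin> S) MoveR) (length w * 2 + 1)
      (env k \<rho>) 0 (env k \<rho>) (int p)" by simp
  have t: "(\<lambda>(b, S). ?j \<notin> S) (tape w (env k \<rho>) (int p)) \<longleftrightarrow> \<rho> i < \<rho> j"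
    using assms by (auto simp: tape_def p_def)
  have "exec w (Cond (\<lambda>(b, S). ?j \<notin> S) (Seq home (Put 0)) home) (2 * length w + 7 + 1)
     (env k \<rho>) (int p) (flag (\<rho> i < \<rho> j) (env k \<rho>)) 0"
    by (rule exec_Cond, unfold t) (rule exec_ret, use p v in \<open>auto simp: valid_def\<close>)
  from exec_Seq[OF 1 this]
  show "exec w (Seq (While (\<lambda>(b, S). ?i \<notin> S \<and> ?j \<notin> S) MoveR)
      (Cond (\<lambda>(b, S). ?j \<notin> S) (Seq home (Put 0)) home))
      (?f (length w)) (env k \<rho>) 0 (flag (\<rho> i < \<rho> j) (env k \<rho>)) 0" .
qed

lemma flag_test [simp]: "E 0 = None \<Longrightarrow> flag b E 0 = Some i \<longleftrightarrow> b \<and> i = 0"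
  by (auto simp: flag_def)

lemma dec_not:
  assumes "dec k P"
  shows "dec k (\<lambda>w \<rho>. \<not> P w \<rho>)"
proof -
  obtain c f where f: "pbound f" and c: "\<And>w \<rho>. valid w k \<rho> \<Longrightarrow>
      exec w c (f (length w)) (env k \<rho>) 0 (flag (P w \<rho>) (env k \<rho>)) 0"
    using assms unfolding dec_def by blast
  show ?thesis
  proof (rule decI)
    show "pbound (\<lambda>n. f n + (1 + 1) + 1)" by (intro pbound_intros f)
    fix w \<rho>
    assume v: "valid w k \<rho>"
    have "exec w (Cond (\<lambda>(b, S). 0 \<in> S) (Del 0) (Put 0)) (1 + 1)
        (flag (P w \<rho>) (env k \<rho>)) 0 (flag (\<not> P w \<rho>) (env k \<rho>)) 0"
    proof (rule exec_Cond)
      let ?E = "flag (P w \<rho>) (env k \<rho>)"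
      have *: "(flag True (env k \<rho>))(0 := None) = env k \<rho>"
        by (auto simp: flag_def fun_eq_iff)
      show "exec w (if (\<lambda>(b, S). 0 \<in> S) (tape w ?E 0) then Del 0 else Put 0) 1 ?E 0
         (flag (\<not> P w \<rho>) (env k \<rho>)) 0"
        using exec_Del[of "flag True (env k \<rho>)" 0 0 w, unfolded *] exec_Put[of "env k \<rho>" 0 w 0]
        by (cases "P w \<rho>") (auto simp: tape_def, auto simp: flag_def)
    qed
    from exec_Seq[OF c[OF v] this]
    show "exec w (Seq c (Cond (\<lambda>(b, S). 0 \<in> S) (Del 0) (Put 0))) (f (length w) + (1 + 1) + 1)
       (env k \<rho>) 0 (flag (\<not> P w \<rho>) (env k \<rho>)) 0" .
  qed
qed

lemma dec_and:
  assumes "dec k P" "dec k Q"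
  shows "dec k (\<lambda>w \<rho>. P w \<rho> \<and> Q w \<rho>)"
proof -
  obtain c f where f: "pbound f" and c: "\<And>w \<rho>. valid w k \<rho> \<Longrightarrow>
      exec w c (f (length w)) (env k \<rho>) 0 (flag (P w \<rho>) (env k \<rho>)) 0"
    using assms(1) unfolding dec_def by blast
  obtain d g where g: "pbound g" and d: "\<And>w \<rho>. valid w k \<rho> \<Longrightarrow>
      exec w d (g (length w)) (env k \<rho>) 0 (flag (Q w \<rho>) (env k \<rho>)) 0"
    using assms(2) unfolding dec_def by blast
  show ?thesis
  proof (rule decI)
    show "pbound (\<lambda>n. f n + ((1 + g n + 1) + 1) + 1)" by (intro pbound_intros f g)
    fix w \<rho>
    assume v: "valid w k \<rho>"
    have "exec w (Cond (\<lambda>(b, S). 0 \<in> S) (Seq (Del 0) d) skip) ((1 + g (length w) + 1) + 1)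
        (flag (P w \<rho>) (env k \<rho>)) 0 (flag (P w \<rho> \<and> Q w \<rho>) (env k \<rho>)) 0"
    proof (rule exec_Cond)
      let ?E = "flag (P w \<rho>) (env k \<rho>)"
      have *: "(flag True (env k \<rho>))(0 := None) = env k \<rho>"
        by (auto simp: flag_def fun_eq_iff)
      show "exec w (if (\<lambda>(b, S). 0 \<in> S) (tape w ?E 0) then Seq (Del 0) d else skip)
         (1 + g (length w) + 1) ?E 0 (flag (P w \<rho> \<and> Q w \<rho>) (env k \<rho>)) 0"
      proof (cases "P w \<rho>")
        case True
        with exec_Seq[OF exec_Del[of "flag True (env k \<rho>)" 0 0 w, unfolded *] d[OF v]]
        show ?thesis by (simp add: tape_def)
      next
        case False
        then show ?thesis using exec_mono[OF exec_skip] by (simp add: tape_def)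
      qed
    qed
    from exec_Seq[OF c[OF v] this]
    show "exec w (Seq c (Cond (\<lambda>(b, S). 0 \<in> S) (Seq (Del 0) d) skip))
       (f (length w) + ((1 + g (length w) + 1) + 1) + 1)
       (env k \<rho>) 0 (flag (P w \<rho> \<and> Q w \<rho>) (env k \<rho>)) 0" .
  qed
qed

definition search :: "nat \<Rightarrow> cmd \<Rightarrow> cmd" where
  "search v c = Seq (Put v) (Seq c (While (\<lambda>(a, S). 0 \<notin> S \<and> 1 \<notin> S)
     (Seq (goto v) (Seq (Del v) (Seq MoveR
        (Cond (\<lambda>(a, S). a \<noteq> 0) (Seq (Put v) (Seq home c)) (Seq MoveL (Seq home (Put 1)))))))))"

text \<open>The result exposes the witness: on success mark \<open>v\<close> stays on a position
  satisfying \<open>Q\<close>, which \<open>dec_iter\<close> takes as its next value and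
  \<open>dec_ex\<close> erases. On failure \<open>v\<close> is gone and mark 1 is set, so that the
  guard of the loop can be read off cell 0.\<close>

lemma exec_search:
  assumes w: "word w" and E: "E v = None" "E 0 = None" "E 1 = None" and v: "v \<ge> 2"
    and c: "\<And>i. i < length w \<Longrightarrow>
      exec w c t (E(v \<mapsto> int i)) 0 (flag (Q i) (E(v \<mapsto> int i))) 0"
  shows "\<exists>E'. exec w (search v c) (length w * (4 * length w + t + 25) + t + 4) E 0 E' 0 \<and>
     ((\<exists>j<length w. Q j \<and> E' = flag True (E(v \<mapsto> int j))) \<or>
      ((\<forall>j<length w. \<not> Q j) \<and> E' = E(1 \<mapsto> 0)))"
proof -
  let ?N = "length w"
  let ?g = "\<lambda>(a, S). 0 \<notin> S \<and> 1 \<notin> S"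
  let ?body = "(Seq (goto v) (Seq (Del v) (Seq MoveR
        (Cond (\<lambda>(a, S). a \<noteq> 0) (Seq (Put v) (Seq home c)) (Seq MoveL (Seq home (Put 1)))))))"
  let ?T = "4 * ?N + t + 25"
  have nz: "w ! q \<noteq> 0" if "q < ?N" for q
    using w that unfolding word_def by (metis nth_mem)
  have N0: "0 < ?N" using w by (auto simp: word_def)
  \<comment> \<open>At the guard \<open>c\<close> has just been run with \<open>v\<close> on
    position \<open>i\<close>, so the flag already shows \<open>Q i\<close>. The induction is on the
    number of positions still ahead.\<close>
  have loop: "\<exists>E'. exec w (While ?g ?body) ((?N - i) * ?T + 1) (flag (Q i) (E(v \<mapsto> int i))) 0 E' 0 \<and>
     ((\<exists>j<?N. Q j \<and> E' = flag True (E(v \<mapsto> int j))) \<or> ((\<forall>j<?N. i \<le> j \<longrightarrow> \<not> Q j) \<and> E' = E(1 \<mapsto> 0)))"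
    if "i < ?N" for i
    using that
  proof (induction "?N - i" arbitrary: i rule: less_induct)
    case less
    let ?E = "E(v \<mapsto> int i)"
    show ?case
    proof (cases "Q i")
      case True
      have "exec w (While ?g ?body) 1 (flag (Q i) ?E) 0 (flag (Q i) ?E) 0"
        by (rule exec_While_stop) (use True E v in \<open>auto simp: tape_def flag_def\<close>)
      then show ?thesis using True less.prems
        by (intro exI[of _ "flag (Q i) ?E"]) (auto intro: exec_mono)
    next
      case False
      have fl: "flag (Q i) ?E = ?E" using False by (simp add: flag_def)
      have g: "?g (tape w ?E 0)" using E v by (auto simp: tape_def)
      have 1: "exec w (goto v) (2 * ?N + 5) ?E 0 ?E (int i)"
        by (rule exec_goto) (use less.prems in auto)
      have 2: "exec w (Del v) 1 ?E (int i) E (int i)"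
        using exec_Del[of ?E v "int i" w] E by (simp add: fun_upd_idem)
      show ?thesis
      proof (cases "Suc i < ?N")
        case True
        let ?E' = "E(v \<mapsto> int (Suc i))"
        have 3: "exec w (Put v) 1 E (int (Suc i)) ?E' (int (Suc i))"
          by (rule exec_Put) (use E in auto)
        have 4: "exec w home (2 * ?N + 5) ?E' (int (Suc i)) ?E' 0"
          by (rule exec_home[OF w True])
        have 5: "exec w (Cond (\<lambda>(a, S). a \<noteq> 0) (Seq (Put v) (Seq home c)) (Seq MoveL (Seq home (Put 1))))
           ((1 + (2 * ?N + 5 + t + 1) + 1) + 1) E (int (Suc i)) (flag (Q (Suc i)) ?E') 0"
          by (rule exec_Cond)
            (use exec_Seq[OF 3 exec_Seq[OF 4 c[OF True]]] True nz[OF True] in \<open>simp add: tape_def nat_add_distrib\<close>)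
        from exec_Seq[OF 1 exec_Seq[OF 2 exec_Seq[OF exec_MoveR_Suc 5]]]
        have b: "exec w ?body (4 * ?N + t + 24) ?E 0 (flag (Q (Suc i)) ?E') 0"
          by (rule exec_mono) simp
        have "?N - Suc i < ?N - i" using True by simp
        from less.hyps[OF this True] obtain E' where
          E': "exec w (While ?g ?body) ((?N - Suc i) * ?T + 1) (flag (Q (Suc i)) ?E') 0 E' 0"
            "(\<exists>j<?N. Q j \<and> E' = flag True (E(v \<mapsto> int j))) \<or> ((\<forall>j<?N. Suc i \<le> j \<longrightarrow> \<not> Q j) \<and> E' = E(1 \<mapsto> 0))"
          by blast
        from exec_While_step[OF g b E'(1)]
        have r: "exec w (While ?g ?body) ((?N - i) * ?T + 1) ?E 0 E' 0"
        proof (rule exec_mono)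
          have "(?N - i) = Suc (?N - Suc i)" using True by simp
          then show "4 * ?N + t + 24 + ((?N - Suc i) * ?T + 1) + 1 \<le> (?N - i) * ?T + 1"
            by simp
        qed
        show ?thesis unfolding fl
          using r E'(2) False by (intro exI[of _ E']) (auto simp: Suc_le_eq order_le_less)
      next
        case F: False
        then have i: "Suc i = ?N" using less.prems by simp
        \<comment> \<open>The head is on the blank behind the input, where \<open>home\<close> would
          stop at once and step further right; hence one move to the left first.\<close>
        have 3: "exec w MoveL 1 E (int (Suc i)) E (int i)"
          using exec_MoveL[of w E "int (Suc i)"] by simp
        have 4: "exec w home (2 * ?N + 5) E (int i) E 0"
          by (rule exec_home[OF w less.prems])
        have p: "exec w (Put 1) 1 E 0 (E(1 \<mapsto> 0)) 0" by (rule exec_Put) (use E in auto)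
        have 5: "exec w (Cond (\<lambda>(a, S). a \<noteq> 0) (Seq (Put v) (Seq home c)) (Seq MoveL (Seq home (Put 1))))
           ((1 + (2 * ?N + 5 + 1 + 1) + 1) + 1) E (int (Suc i)) (E(1 \<mapsto> 0)) 0"
          by (rule exec_Cond)
            (use exec_Seq[OF 3 exec_Seq[OF 4 p]] i in \<open>simp add: tape_def\<close>)
        from exec_Seq[OF 1 exec_Seq[OF 2 exec_Seq[OF exec_MoveR_Suc 5]]]
        have b: "exec w ?body (4 * ?N + t + 24) ?E 0 (E(1 \<mapsto> 0)) 0"
          by (rule exec_mono) simp
        have s: "exec w (While ?g ?body) 1 (E(1 \<mapsto> 0)) 0 (E(1 \<mapsto> 0)) 0"
          by (rule exec_While_stop) (auto simp: tape_def)
        have r: "exec w (While ?g ?body) ((?N - i) * ?T + 1) ?E 0 (E(1 \<mapsto> 0)) 0"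
        proof (rule exec_mono[OF exec_While_step[OF g b s]])
          have "?N - i = 1" using i by simp
          then show "4 * ?N + t + 24 + 1 + 1 \<le> (?N - i) * ?T + 1" by simp
        qed
        have "\<not> Q j" if "j < ?N" "i \<le> j" for j
          using False i that by (cases "j = i") auto
        then show ?thesis unfolding fl
          using r by (intro exI[of _ "E(1 \<mapsto> 0)"]) blast
      qed
    qed
  qed
  have p: "exec w (Put v) 1 E 0 (E(v \<mapsto> int 0)) 0" using exec_Put[of E v w 0] E by simp
  from loop[OF N0] obtain E' where
    E': "exec w (While ?g ?body) (?N * ?T + 1) (flag (Q 0) (E(v \<mapsto> int 0))) 0 E' 0"
      "(\<exists>j<?N. Q j \<and> E' = flag True (E(v \<mapsto> int j))) \<or> ((\<forall>j<?N. \<not> Q j) \<and> E' = E(1 \<mapsto> 0))"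
    by auto
  have "exec w (search v c) (?N * ?T + t + 4) E 0 E' 0"
    unfolding search_def
    by (rule exec_mono[OF exec_Seq[OF p exec_Seq[OF c[OF N0] E'(1)]]]) simp
  with E'(2) show ?thesis by blast
qed

lemma exec_Put': "E v = None \<Longrightarrow> E' = E(v \<mapsto> h) \<Longrightarrow> exec w (Put v) 1 E h E' h"
  using exec_Put by simp

lemma exec_Del': "E v = Some h \<Longrightarrow> E' = E(v := None) \<Longrightarrow> exec w (Del v) 1 E h E' h"
  using exec_Del by simp

lemma env_none: "v \<ge> k + 2 \<Longrightarrow> env k \<rho> v = None"
  by (simp add: env_def)

text \<open>The bound variable is the first free index \<open>k\<close>. The second premise says
  that \<open>Q\<close> reads it only through its last argument, which expresses scoping without any
  syntax of formulas.\<close>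

lemma dec_ex:
  assumes "dec (Suc k) (\<lambda>w \<rho>. Q w \<rho> (\<rho> k))"
    and "\<And>w \<rho> i j. Q w (\<rho>(k := j)) i = Q w \<rho> i"
  shows "dec k (\<lambda>w \<rho>. \<exists>i<length w. Q w \<rho> i)"
proof -
  obtain c f where f: "pbound f" and c: "\<And>w \<rho>. valid w (Suc k) \<rho> \<Longrightarrow>
      exec w c (f (length w)) (env (Suc k) \<rho>) 0 (flag (Q w \<rho> (\<rho> k)) (env (Suc k) \<rho>)) 0"
    using assms(1) unfolding dec_def by blast
  let ?v = "k + 2"
  let ?fin = "Cond (\<lambda>(a, S). 0 \<in> S) (Seq (goto ?v) (Seq (Del ?v) home)) (Del 1)"
  let ?f = "\<lambda>n. (n * (4 * n + f n + 25) + f n + 4) + (((2 * n + 5) + (1 + (2 * n + 5) + 1) + 1) + 1) + 1"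
  show ?thesis
  proof (rule decI)
    show "pbound ?f" by (intro pbound_intros f)
    fix w \<rho>
    assume v: "valid w k \<rho>"
    let ?E = "env k \<rho>"
    have w: "word w" using v by (simp add: valid_def)
    have "exec w c (f (length w)) (?E(?v \<mapsto> int i)) 0 (flag (Q w \<rho> i) (?E(?v \<mapsto> int i))) 0"
      if "i < length w" for i
      using c[OF valid_Suc[OF v that]] by (simp add: env_Suc assms(2))
    from exec_search[OF w _ _ _ _ this] obtain E' where
      E': "exec w (search ?v c) (length w * (4 * length w + f (length w) + 25) + f (length w) + 4) ?E 0 E' 0"
        "(\<exists>j<length w. Q w \<rho> j \<and> E' = flag True (?E(?v \<mapsto> int j))) \<or>
         ((\<forall>j<length w. \<not> Q w \<rho> j) \<and> E' = ?E(1 \<mapsto> 0))"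
      by (auto simp: env_none)
    have "exec w ?fin (((2 * length w + 5) + (1 + (2 * length w + 5) + 1) + 1) + 1) E' 0
       (flag (\<exists>i<length w. Q w \<rho> i) ?E) 0"
      using E'(2)
    proof
      assume "\<exists>j<length w. Q w \<rho> j \<and> E' = flag True (?E(?v \<mapsto> int j))"
      then obtain j where j: "j < length w" "Q w \<rho> j" "E' = flag True (?E(?v \<mapsto> int j))" by blast
      have 1: "exec w (goto ?v) (2 * length w + 5) E' 0 E' (int j)"
        by (rule exec_goto) (use j in \<open>auto simp: flag_def\<close>)
      have 2: "exec w (Del ?v) 1 E' (int j) (flag True ?E) (int j)"
        by (rule exec_Del') (use j in \<open>auto simp: flag_def fun_eq_iff\<close>)
      have 3: "exec w home (2 * length w + 5) (flag True ?E) (int j) (flag True ?E) 0"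
        by (rule exec_home[OF w j(1)])
      have "(\<exists>i<length w. Q w \<rho> i) = True" using j by blast
      then show ?thesis
        using j by (intro exec_Cond)
          (use exec_Seq[OF 1 exec_Seq[OF 2 3]] in \<open>auto simp: tape_def flag_def\<close>)
    next
      assume a: "(\<forall>j<length w. \<not> Q w \<rho> j) \<and> E' = ?E(1 \<mapsto> 0)"
      have "exec w (Del 1) 1 E' 0 ?E 0"
        by (rule exec_Del') (use a in \<open>auto simp: fun_eq_iff\<close>)
      from exec_mono[OF this] have d: "exec w (Del 1) ((2 * length w + 5) + (1 + (2 * length w + 5) + 1) + 1) E' 0 ?E 0"
        by simp
      have "(\<exists>i<length w. Q w \<rho> i) = False" using a by blast
      then show ?thesis
        using a by (intro exec_Cond) (use d in \<open>auto simp: tape_def flag_def\<close>)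
    qed
    from exec_Seq[OF E'(1) this]
    show "exec w (Seq (search ?v c) ?fin) (?f (length w)) ?E 0 (flag (\<exists>i<length w. Q w \<rho> i) ?E) 0" .
  qed
qed

text \<open>This closure rule supplies the arithmetic: iterating the successor gives addition, and
  iterating addition gives multiplication. Since positions are bounded, the iterated function h has
  to get stuck where the relation R has no successor.\<close>

lemma dec_iter:
  assumes P: "dec (k + 3) P"
    and R: "\<And>w \<rho> i x y. P w (\<rho>(k := i, k + 1 := x, k + 2 := y)) = R w \<rho> x y"
    and h: "\<And>w \<rho> x. valid w k \<rho> \<Longrightarrow> x < length w \<Longrightarrow> h w \<rho> x < length w"
    and hR: "\<And>w \<rho> x y. valid w k \<rho> \<Longrightarrow> x < length w \<Longrightarrow> y < length w \<Longrightarrow> R w \<rho> x y \<Longrightarrow> y = h w \<rho> x"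
    and hn: "\<And>w \<rho> x. valid w k \<rho> \<Longrightarrow> x < length w \<Longrightarrow> \<forall>y<length w. \<not> R w \<rho> x y \<Longrightarrow> h w \<rho> x = x"
    and abj: "a < k" "b < k" "j < k"
  shows "dec k (\<lambda>w \<rho>. (h w \<rho> ^^ \<rho> j) (\<rho> a) = \<rho> b)"
proof -
  obtain c f where f: "pbound f" and c: "\<And>w \<rho>. valid w (k + 3) \<rho> \<Longrightarrow>
      exec w c (f (length w)) (env (k + 3) \<rho>) 0 (flag (P w \<rho>) (env (k + 3) \<rho>)) 0"
    using P unfolding dec_def by blast
  \<comment> \<open>\<open>vc\<close> is the round counter, \<open>vu\<close> the current iterate,
    \<open>vv\<close> the candidate for the next one. They are the marks of the variables
    \<open>k\<close>, \<open>k + 1\<close>, \<open>k + 2\<close>, so during a search the tape is an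
    environment for \<open>P\<close>, whose value does not depend on the counter by assumption
    \<open>R\<close>.\<close>
  define vc vu vv va vb vj where marks: "vc = k + 2" "vu = k + 3" "vv = k + 4"
    "va = a + 2" "vb = b + 2" "vj = j + 2"
  let ?upd = "Cond (\<lambda>(a, S). 0 \<in> S)
     (Seq (Del 0) (Seq (goto vu) (Seq (Del vu) (Seq home (Seq (goto vv) (Seq (Del vv) (Seq (Put vu) home)))))))
     (Del 1)"
  \<comment> \<open>The head is left on the new counter cell, so the loop guard compares the counter
    with \<open>\<rho> j\<close> by looking for \<open>vj\<close> under the head.\<close>
  let ?inc = "Seq (goto vc) (Seq (Del vc) (Seq MoveR (Put vc)))"
  let ?body = "Seq home (Seq (Seq (search vv c) ?upd) ?inc)"
  let ?pre = "Seq (Put vc) (Seq (goto va) (Seq (Put vu) home))"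
  let ?post = "Seq (Del vc) (Seq home (Seq (goto vu) (Seq (Del vu) (Cond (\<lambda>(a, S). vb \<in> S) (Seq home (Put 0)) home))))"
  let ?loop = "While (\<lambda>(a, S). vj \<notin> S) ?body"
  let ?ts = "\<lambda>n. n * (4 * n + f n + 25) + f n + 4"
  let ?tb = "\<lambda>n. ?ts n + 20 * n + 80"
  let ?tl = "\<lambda>n. n * (?tb n + 1) + 1"
  let ?f = "\<lambda>n. ?tl n + 20 * n + 80"
  show ?thesis
  proof (rule decI)
    show "pbound ?f" by (intro pbound_intros f)
    fix w \<rho>
    assume v: "valid w k \<rho>"
    let ?N = "length w"
    have w: "word w" using v by (simp add: valid_def)
    have \<rho>: "\<rho> a < ?N" "\<rho> b < ?N" "\<rho> j < ?N" using v abj by (auto simp: valid_def)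
    define E where "E = env k \<rho>"
    define S where "S i x = E(vc \<mapsto> int i, vu \<mapsto> int x)" for i x
    define H where "H i = (h w \<rho> ^^ i) (\<rho> a)" for i
    have E: "E 0 = None" "E (Suc 0) = None" "E vc = None" "E vu = None" "E vv = None"
      "E va = Some (int (\<rho> a))" "E vb = Some (int (\<rho> b))" "E vj = Some (int (\<rho> j))"
      using abj by (auto simp: E_def env_def marks)
    have ne: "vc \<noteq> vu" "vc \<noteq> vv" "vu \<noteq> vv" "vc \<noteq> 0" "vu \<noteq> 0" "vv \<noteq> 0"
      "vc \<noteq> Suc 0" "vu \<noteq> Suc 0" "vv \<noteq> Suc 0" "vv \<ge> 2"
      "va \<noteq> vc" "va \<noteq> vu" "vb \<noteq> vc" "vb \<noteq> vu" "vj \<noteq> vc" "vj \<noteq> vu"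
      using abj by (auto simp: marks)
    note [simp] = E ne ne(1-9)[symmetric] ne(11-16)[symmetric] S_def
    have HN: "H i < ?N" for i
      unfolding H_def by (induction i) (use h v \<rho> in auto)
    have upd: "exec w (Seq (search vv c) ?upd) (?ts ?N + 8 * ?N + 40) (S i x) 0 (S i (h w \<rho> x)) 0"
      if i: "i < ?N" and x: "x < ?N" for i x
    proof -
      have "exec w c (f ?N) ((S i x)(vv \<mapsto> int y)) 0 (flag (R w \<rho> x y) ((S i x)(vv \<mapsto> int y))) 0"
        if y: "y < ?N" for y
      proof -
        have "valid w (k + 3) (\<rho>(k := i, k + 1 := x, k + 2 := y))"
          using v i x y by (auto simp: valid_def)
        note c[OF this]
        moreover have "env (k + 3) (\<rho>(k := i, k + 1 := x, k + 2 := y)) = (S i x)(vv \<mapsto> int y)"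
          by (auto simp: E_def env_def marks fun_eq_iff)
        ultimately show ?thesis by (simp only: R)
      qed
      from exec_search[OF w _ _ _ _ this] obtain E' where
        E': "exec w (search vv c) (?ts ?N) (S i x) 0 E' 0"
          "(\<exists>y<?N. R w \<rho> x y \<and> E' = flag True ((S i x)(vv \<mapsto> int y))) \<or>
           ((\<forall>y<?N. \<not> R w \<rho> x y) \<and> E' = (S i x)(1 \<mapsto> 0))"
        by auto
      have "exec w ?upd (8 * ?N + 39) E' 0 (S i (h w \<rho> x)) 0"
        using E'(2)
      proof
        assume "\<exists>y<?N. R w \<rho> x y \<and> E' = flag True ((S i x)(vv \<mapsto> int y))"
        then obtain y where y: "y < ?N" "y = h w \<rho> x" "E' = flag True ((S i x)(vv \<mapsto> int y))"
          using hR v x by blast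
        let ?E1 = "(S i x)(vv \<mapsto> int y)" and ?E2 = "E(vc \<mapsto> int i, vv \<mapsto> int y)"
        have 1: "exec w (Del 0) 1 E' 0 ?E1 0"
          by (rule exec_Del') (use y in \<open>auto simp: flag_def fun_eq_iff\<close>)
        have 2: "exec w (goto vu) (2 * ?N + 5) ?E1 0 ?E1 (int x)"
          by (rule exec_goto) (use x in auto)
        have 3: "exec w (Del vu) 1 ?E1 (int x) ?E2 (int x)"
          by (rule exec_Del') (auto simp: fun_eq_iff)
        have 4: "exec w home (2 * ?N + 5) ?E2 (int x) ?E2 0"
          by (rule exec_home[OF w x])
        have 5: "exec w (goto vv) (2 * ?N + 5) ?E2 0 ?E2 (int y)"
          by (rule exec_goto) (use y in auto)
        have 6: "exec w (Del vv) 1 ?E2 (int y) (E(vc \<mapsto> int i)) (int y)"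
          by (rule exec_Del') (auto simp: fun_eq_iff)
        have 7: "exec w (Put vu) 1 (E(vc \<mapsto> int i)) (int y) (S i y) (int y)"
          by (rule exec_Put') (auto simp: fun_eq_iff)
        have 8: "exec w home (2 * ?N + 5) (S i y) (int y) (S i y) 0"
          by (rule exec_home[OF w y(1)])
        note all = exec_Seq[OF 1 exec_Seq[OF 2 exec_Seq[OF 3 exec_Seq[OF 4 exec_Seq[OF 5 exec_Seq[OF 6 exec_Seq[OF 7 8]]]]]]]
        have t: "(\<lambda>(a, S). 0 \<in> S) (tape w E' 0)" using y by (auto simp: tape_def flag_def)
        from exec_Cond[where b = "\<lambda>(a, S). 0 \<in> S" and w = w and E = E' and h = 0, unfolded if_P[OF t], OF all]
        show ?thesis unfolding y(2)[symmetric] by (rule exec_mono) simp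
      next
        assume a: "(\<forall>y<?N. \<not> R w \<rho> x y) \<and> E' = (S i x)(1 \<mapsto> 0)"
        have hx: "h w \<rho> x = x" using hn v x a by blast
        have d: "exec w (Del 1) 1 E' 0 (S i x) 0"
          by (rule exec_Del') (use a in \<open>auto simp: fun_eq_iff\<close>)
        have t: "\<not> (\<lambda>(a, S). 0 \<in> S) (tape w E' 0)" using a by (auto simp: tape_def flag_def)
        from exec_Cond[where b = "\<lambda>(a, S). 0 \<in> S" and w = w and E = E' and h = 0, unfolded if_not_P[OF t], OF d]
        show ?thesis unfolding hx by (rule exec_mono) simp
      qed
      from exec_Seq[OF E'(1) this] show ?thesis by (rule exec_mono) simp
    qed
    have inc: "exec w ?inc (2 * ?N + 12) (S i x) 0 (S (Suc i) x) (int (Suc i))" if i: "i < ?N" for i x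
    proof -
      have 1: "exec w (goto vc) (2 * ?N + 5) (S i x) 0 (S i x) (int i)"
        by (rule exec_goto) (use i in auto)
      have 2: "exec w (Del vc) 1 (S i x) (int i) (E(vu \<mapsto> int x)) (int i)"
        by (rule exec_Del') (auto simp: fun_eq_iff)
      have 3: "exec w (Put vc) 1 (E(vu \<mapsto> int x)) (int (Suc i)) (S (Suc i) x) (int (Suc i))"
        by (rule exec_Put') (auto simp: fun_eq_iff)
      from exec_Seq[OF 1 exec_Seq[OF 2 exec_Seq[OF exec_MoveR_Suc 3]]] show ?thesis
        by (rule exec_mono) simp
    qed
    have body: "exec w ?body (?tb ?N) (S i (H i)) (int i) (S (Suc i) (H (Suc i))) (int (Suc i))"
      if i: "i < ?N" for i
    proof -
      have HS: "H (Suc i) = h w \<rho> (H i)" by (simp add: H_def)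
      from exec_Seq[OF exec_home[OF w i, of "S i (H i)"] exec_Seq[OF upd[OF i HN[of i]] inc[OF i]]]
      show ?thesis unfolding HS by (rule exec_mono) simp
    qed
    have loop: "exec w ?loop (?tl ?N) (S 0 (H 0)) (int 0) (S (\<rho> j) (H (\<rho> j))) (int (\<rho> j))"
    proof (rule exec_mono)
      show "exec w ?loop (\<rho> j * (?tb ?N + 1) + 1) (S 0 (H 0)) (int 0) (S (\<rho> j) (H (\<rho> j))) (int (\<rho> j))"
      proof (rule exec_For[where F = "\<lambda>i. S i (H i)" and p = int])
        fix i
        assume i: "i < \<rho> j"
        then show "(\<lambda>(a, S). vj \<notin> S) (tape w (S i (H i)) (int i))"
          by (auto simp: tape_def)
        show "exec w ?body (?tb ?N) (S i (H i)) (int i) (S (Suc i) (H (Suc i))) (int (Suc i))"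
          by (rule body) (use i \<rho> in simp)
      qed (auto simp: tape_def)
      show "\<rho> j * (?tb ?N + 1) + 1 \<le> ?tl ?N"
        by (intro add_le_mono mult_le_mono) (use \<rho> in auto)
    qed
    have pre: "exec w ?pre (4 * ?N + 20) E 0 (S 0 (H 0)) (int 0)"
    proof -
      have 1: "exec w (Put vc) 1 E 0 (E(vc \<mapsto> int 0)) 0"
        by (rule exec_Put') auto
      have 2: "exec w (goto va) (2 * ?N + 5) (E(vc \<mapsto> int 0)) 0 (E(vc \<mapsto> int 0)) (int (\<rho> a))"
        by (rule exec_goto) (use \<rho> in auto)
      have 3: "exec w (Put vu) 1 (E(vc \<mapsto> int 0)) (int (\<rho> a)) (S 0 (\<rho> a)) (int (\<rho> a))"
        by (rule exec_Put') auto
      have H0: "H 0 = \<rho> a" by (simp add: H_def)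
      from exec_Seq[OF 1 exec_Seq[OF 2 exec_Seq[OF 3 exec_home[OF w \<rho>(1)]]]]
      show ?thesis unfolding H0 of_nat_0 by (rule exec_mono) simp
    qed
    have post: "exec w ?post (6 * ?N + 30) (S i x) (int i) (flag (x = \<rho> b) E) 0"
      if i: "i < ?N" and x: "x < ?N" for i x
    proof -
      let ?E1 = "E(vu \<mapsto> int x)"
      have 1: "exec w (Del vc) 1 (S i x) (int i) ?E1 (int i)"
        by (rule exec_Del') (auto simp: fun_eq_iff)
      have 2: "exec w home (2 * ?N + 5) ?E1 (int i) ?E1 0"
        by (rule exec_home[OF w i])
      have 3: "exec w (goto vu) (2 * ?N + 5) ?E1 0 ?E1 (int x)"
        by (rule exec_goto) (use x in auto)
      have 4: "exec w (Del vu) 1 ?E1 (int x) E (int x)"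
        by (rule exec_Del') (auto simp: fun_eq_iff)
      have t: "(\<lambda>(a, S). vb \<in> S) (tape w E (int x)) \<longleftrightarrow> x = \<rho> b"
        by (auto simp: tape_def)
      have 5: "exec w (Cond (\<lambda>(a, S). vb \<in> S) (Seq home (Put 0)) home) (2 * ?N + 7 + 1) E (int x) (flag (x = \<rho> b) E) 0"
        by (rule exec_Cond, unfold t) (rule exec_ret[OF w x], simp)
      from exec_Seq[OF 1 exec_Seq[OF 2 exec_Seq[OF 3 exec_Seq[OF 4 5]]]]
      show ?thesis by (rule exec_mono) simp
    qed
    from exec_Seq[OF pre exec_Seq[OF loop post[OF \<rho>(3) HN]]]
    have "exec w (Seq ?pre (Seq ?loop ?post)) (?f ?N) E 0 (flag (H (\<rho> j) = \<rho> b) E) 0"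
      by (rule exec_mono) simp
    then show "exec w (Seq ?pre (Seq ?loop ?post)) (?f ?N) (env k \<rho>) 0
       (flag ((h w \<rho> ^^ \<rho> j) (\<rho> a) = \<rho> b) (env k \<rho>)) 0"
      unfolding H_def E_def .
  qed
qed

section \<open>Derived connectives, bounded quantifiers and arithmetic of positions\<close>

lemma dec_or:
  assumes "dec k P" "dec k Q"
  shows "dec k (\<lambda>w \<rho>. P w \<rho> \<or> Q w \<rho>)"
proof -
  have "dec k (\<lambda>w \<rho>. \<not> (\<not> P w \<rho> \<and> \<not> Q w \<rho>))" by (intro dec_not dec_and assms)
  then show ?thesis by simp
qed

lemma dec_imp:
  assumes "dec k P" "dec k Q"
  shows "dec k (\<lambda>w \<rho>. P w \<rho> \<longrightarrow> Q w \<rho>)"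
proof -
  have "dec k (\<lambda>w \<rho>. \<not> P w \<rho> \<or> Q w \<rho>)" by (intro dec_not dec_or assms)
  then show ?thesis by (simp only: imp_conv_disj)
qed

lemma dec_iff:
  assumes "dec k P" "dec k Q"
  shows "dec k (\<lambda>w \<rho>. P w \<rho> \<longleftrightarrow> Q w \<rho>)"
proof -
  have "dec k (\<lambda>w \<rho>. (P w \<rho> \<longrightarrow> Q w \<rho>) \<and> (Q w \<rho> \<longrightarrow> P w \<rho>))" by (intro dec_and dec_imp assms)
  then show ?thesis by (simp only: iff_conv_conj_imp)
qed

lemma dec_eq:
  assumes "i < k" "j < k"
  shows "dec k (\<lambda>w \<rho>. \<rho> i = \<rho> j)"
proof (rule dec_cong)
  show "dec k (\<lambda>w \<rho>. \<not> \<rho> i < \<rho> j \<and> \<not> \<rho> j < \<rho> i)"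
    by (intro dec_and dec_not dec_less assms)
qed auto

lemma dec_ex_lt:
  assumes "dec (Suc k) (\<lambda>w \<rho>. Q w \<rho> (\<rho> k))"
    and "\<And>w \<rho> i j. Q w (\<rho>(k := j)) i = Q w \<rho> i" and a: "a < k"
  shows "dec k (\<lambda>w \<rho>. \<exists>i<\<rho> a. Q w \<rho> i)"
proof (rule dec_cong)
  show "dec k (\<lambda>w \<rho>. \<exists>i<length w. i < \<rho> a \<and> Q w \<rho> i)"
    by (intro dec_ex dec_and dec_less assms) (use a assms in auto)
qed (use a in \<open>auto simp: valid_def\<close>, meson less_trans)

lemma dec_all_lt:
  assumes "dec (Suc k) (\<lambda>w \<rho>. Q w \<rho> (\<rho> k))"
    and "\<And>w \<rho> i j. Q w (\<rho>(k := j)) i = Q w \<rho> i" and a: "a < k"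
  shows "dec k (\<lambda>w \<rho>. \<forall>i<\<rho> a. Q w \<rho> i)"
proof (rule dec_cong)
  show "dec k (\<lambda>w \<rho>. \<not> (\<exists>i<\<rho> a. \<not> Q w \<rho> i))"
    by (intro dec_ex_lt dec_not assms) (use a assms in auto)
qed auto

lemma dec_Suc:
  assumes "i < k" "j < k"
  shows "dec k (\<lambda>w \<rho>. \<rho> i = Suc (\<rho> j))"
proof (rule dec_cong)
  show "dec k (\<lambda>w \<rho>. \<rho> j < \<rho> i \<and> \<not> (\<exists>m<\<rho> i. \<rho> j < m))"
    by (intro dec_ex_lt dec_not dec_and dec_less) (use assms in auto)
qed (auto simp: not_less less_eq_Suc_le, metis le_antisym not_less_eq_eq)

lemma dec_const:
  assumes "i < k"
  shows "dec k (\<lambda>w \<rho>. \<rho> i = c)"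
  using assms
proof (induction c arbitrary: i k)
  case 0
  show ?case
  proof (rule dec_cong)
    \<comment> \<open>The equation only serves as a true formula: 0 is the position with none below
      it.\<close>
    show "dec k (\<lambda>w \<rho>. \<not> (\<exists>m<\<rho> i. \<rho> i = \<rho> i))"
      by (intro dec_ex_lt dec_not dec_eq) (use 0 in auto)
  qed auto
next
  case (Suc c)
  show ?case
  proof (rule dec_cong)
    show "dec k (\<lambda>w \<rho>. \<exists>m<\<rho> i. \<rho> i = Suc m \<and> m = c)"
      by (intro dec_ex_lt dec_and dec_Suc Suc.IH) (use Suc.prems in auto)
  qed auto
qed

lemma dec_plus:
  assumes "a < k" "b < k" "j < k"
  shows "dec k (\<lambda>w \<rho>. \<rho> a + \<rho> j = \<rho> b)"
proof -
  define h :: "nat list \<Rightarrow> nat \<Rightarrow> nat"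
    where "h w x = (if Suc x < length w then Suc x else x)" for w x
  have h: "(h w ^^ n) x = min (x + n) (length w - 1)" if "x < length w" for w n x
    using that by (induction n) (auto simp: h_def)
  show ?thesis
  proof (rule dec_cong)
    have "dec (Suc (Suc k)) (\<lambda>w \<rho>. (h w ^^ \<rho> k) (\<rho> a) = \<rho> (Suc k))"
    proof (rule dec_iter[where h = "\<lambda>w _. h w" and R = "\<lambda>w \<rho> x y. y = Suc x"])
      show "dec (Suc (Suc k) + 3) (\<lambda>w \<rho>. \<rho> (k + 4) = Suc (\<rho> (k + 3)))"
        by (rule dec_Suc) auto
    qed (use assms in \<open>auto simp: h_def numeral_eq_Suc\<close>)
    \<comment> \<open>At the last position the saturated iterate does not tell whether the sum has
      overflowed. Comparing the predecessors, \<open>i\<close> rounds against \<open>c\<close>,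
      keeps the target below the last position, where an iterate is never saturated.\<close>
    then show "dec k (\<lambda>w \<rho>. (\<rho> j = 0 \<and> \<rho> a = \<rho> b) \<or> (\<exists>i<\<rho> j. \<exists>c<\<rho> b. \<rho> j = Suc i \<and> \<rho> b = Suc c \<and>
        (h w ^^ i) (\<rho> a) = c))"
      by (intro dec_or dec_and dec_const dec_eq dec_ex_lt dec_Suc) (use assms in \<open>auto simp: h_def\<close>)
  next
    fix w \<rho>
    assume v: "valid w k \<rho>"
    then have "\<rho> a < length w" "\<rho> b < length w" using assms by (auto simp: valid_def)
    then show "((\<rho> j = 0 \<and> \<rho> a = \<rho> b) \<or> (\<exists>i<\<rho> j. \<exists>c<\<rho> b. \<rho> j = Suc i \<and> \<rho> b = Suc c \<and>
        (h w ^^ i) (\<rho> a) = c)) = (\<rho> a + \<rho> j = \<rho> b)"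
      by (cases "\<rho> j"; cases "\<rho> b") (auto simp: h)
  qed
qed

lemma dec_times:
  assumes "a < k" "b < k" "j < k"
  shows "dec k (\<lambda>w \<rho>. \<rho> j * \<rho> a = \<rho> b)"
proof -
  define h :: "nat list \<Rightarrow> nat \<Rightarrow> nat \<Rightarrow> nat"
    where "h w s x = (if x + s < length w then x + s else x)" for w s x
  have h: "(h w s ^^ n) 0 = n * s \<or> (h w s ^^ n) 0 + s \<ge> length w" for w s n
    by (induction n) (auto simp: h_def)
  have h': "n * s < length w \<Longrightarrow> (h w s ^^ n) 0 = n * s" for w s n
    by (induction n) (auto simp: h_def)
  show ?thesis
  proof (rule dec_cong)
    have "dec (Suc (Suc (Suc k))) (\<lambda>w \<rho>. (h w (\<rho> a) ^^ \<rho> k) (\<rho> (Suc (Suc k))) = \<rho> (Suc k))"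
    proof (rule dec_iter[where h = "\<lambda>w \<rho>. h w (\<rho> a)" and R = "\<lambda>w \<rho> x y. x + \<rho> a = y"])
      show "dec (Suc (Suc (Suc k)) + 3) (\<lambda>w \<rho>. \<rho> (k + 4) + \<rho> a = \<rho> (k + 5))"
        by (rule dec_plus) (use assms in auto)
    qed (use assms in \<open>auto simp: h_def numeral_eq_Suc\<close>)
    \<comment> \<open>The last of the \<open>\<rho> j\<close> additions is made by
      \<open>c + \<rho> a = \<rho> b\<close> and not by iteration. Its result is in range, which
      excludes a stuck iterate, the second case of \<open>h\<close>. The start value 0 is held by a
      variable \<open>z\<close> because \<open>dec_iter\<close> starts from a variable.\<close>
    then show "dec k (\<lambda>w \<rho>. (\<rho> j = 0 \<and> \<rho> b = 0) \<or> (\<exists>i<\<rho> j. \<exists>c<length w. \<rho> j = Suc i \<and> c + \<rho> a = \<rho> b \<and>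
        (\<exists>z<length w. z = 0 \<and> (h w (\<rho> a) ^^ i) z = c)))"
      by (intro dec_or dec_and dec_const dec_ex_lt dec_ex dec_Suc dec_plus) (use assms in \<open>auto simp: h_def\<close>)
  next
    fix w \<rho>
    assume v: "valid w k \<rho>"
    then have b: "\<rho> b < length w" "0 < length w" using assms valid_pos by (auto simp: valid_def)
    show "((\<rho> j = 0 \<and> \<rho> b = 0) \<or> (\<exists>i<\<rho> j. \<exists>c<length w. \<rho> j = Suc i \<and> c + \<rho> a = \<rho> b \<and>
        (\<exists>z<length w. z = 0 \<and> (h w (\<rho> a) ^^ i) z = c))) = (\<rho> j * \<rho> a = \<rho> b)"
    proof (cases "\<rho> j")
      case (Suc n)
      have "(h w (\<rho> a) ^^ n) 0 + \<rho> a = \<rho> b \<longleftrightarrow> Suc n * \<rho> a = \<rho> b"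
        using h[of n w "\<rho> a"] h'[of n "\<rho> a" w] b by auto
      moreover have "(h w (\<rho> a) ^^ n) 0 + \<rho> a = \<rho> b \<Longrightarrow> (h w (\<rho> a) ^^ n) 0 < length w" using b by simp
      ultimately show ?thesis using Suc b by auto
    qed auto
  qed
qed

lemma dec_add_const:
  assumes "i < k" "j < k"
  shows "dec k (\<lambda>w \<rho>. \<rho> i = \<rho> j + c)"
proof (rule dec_cong)
  show "dec k (\<lambda>w \<rho>. \<exists>t<length w. t = c \<and> \<rho> j + t = \<rho> i)"
    by (intro dec_ex dec_and dec_const dec_plus) (use assms in auto)
qed (use assms in \<open>fastforce simp: valid_def\<close>)

lemma dec_double:
  assumes "i < k" "j < k"
  shows "dec k (\<lambda>w \<rho>. \<rho> i = 2 * \<rho> j)"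
  by (rule dec_cong[OF dec_plus[of j k i j]]) (use assms in auto)

lemma dec_double_Suc:
  assumes "i < k" "j < k"
  shows "dec k (\<lambda>w \<rho>. \<rho> i = Suc (2 * \<rho> j))"
proof (rule dec_cong)
  show "dec k (\<lambda>w \<rho>. \<exists>t<\<rho> i. t = 2 * \<rho> j \<and> \<rho> i = Suc t)"
    by (intro dec_ex_lt dec_and dec_double dec_Suc) (use assms in auto)
qed auto

text \<open>Five cubes of side \<open>m\<close> lie one after the other behind the separator, in
  row-major order. The Horner form lets the address be computed by alternating products and sums of
  positions; \<open>r < length w\<close> reflects that the literal \<open>r\<close> itself has to be
  a position in the formula of \<open>dec_table\<close>.\<close>

definition table :: "nat list \<Rightarrow> nat \<Rightarrow> nat \<Rightarrow> nat \<Rightarrow> nat \<Rightarrow> nat \<Rightarrow> bool" where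
  "table w m r i j l \<longleftrightarrow>
     (let q = Suc m + (((r * m + i) * m + j) * m + l) in r < length w \<and> q < length w \<and> w ! q = 2)"

lemma dec_table:
  assumes "m < k" "i < k" "j < k" "l < k"
  shows "dec k (\<lambda>w \<rho>. table w (\<rho> m) r (\<rho> i) (\<rho> j) (\<rho> l))"
proof (rule dec_cong)
  show "dec k (\<lambda>w \<rho>. \<exists>a<length w. a = r \<and> (\<exists>b<length w. a * \<rho> m = b \<and> (\<exists>c<length w. b + \<rho> i = c \<and>
     (\<exists>d<length w. c * \<rho> m = d \<and> (\<exists>e<length w. d + \<rho> j = e \<and> (\<exists>f<length w. e * \<rho> m = f \<and>
     (\<exists>g<length w. f + \<rho> l = g \<and> (\<exists>h<length w. h = Suc (\<rho> m) \<and> (\<exists>q<length w. h + g = q \<and> w ! q = 2)))))))))"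
    by (intro dec_ex dec_and dec_const dec_plus dec_times dec_Suc dec_sym) (use assms in auto)
next
  fix w \<rho>
  assume v: "valid w k \<rho>"
  define c where "c = r * \<rho> m + \<rho> i"
  define e where "e = c * \<rho> m + \<rho> j"
  \<comment> \<open>An intermediate Horner value is at most the final address if
    \<open>\<rho> m\<close> is positive; for \<open>\<rho> m = 0\<close> it collapses to one of the
    given positions.\<close>
  have le: "x < length w" if "x * \<rho> m + y < length w" "\<rho> m = 0 \<Longrightarrow> x < length w" for x y
    using that by (cases "\<rho> m") auto
  have ij: "\<rho> i < length w" "\<rho> j < length w" using v assms by (auto simp: valid_def)
  have e: "e < length w" if "Suc (\<rho> m + (e * \<rho> m + \<rho> l)) < length w"
    by (rule le[of _ "\<rho> l"]) (use that ij in \<open>auto simp: e_def\<close>)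
  moreover have "c < length w" if "e < length w"
    by (rule le[of _ "\<rho> j"]) (use that ij in \<open>auto simp: e_def c_def\<close>)
  ultimately have "c < length w \<and> e < length w" if "Suc (\<rho> m + (e * \<rho> m + \<rho> l)) < length w"
    using that by blast
  then show "(\<exists>a<length w. a = r \<and> (\<exists>b<length w. a * \<rho> m = b \<and> (\<exists>c<length w. b + \<rho> i = c \<and>
     (\<exists>d<length w. c * \<rho> m = d \<and> (\<exists>e<length w. d + \<rho> j = e \<and> (\<exists>f<length w. e * \<rho> m = f \<and>
     (\<exists>g<length w. f + \<rho> l = g \<and> (\<exists>h<length w. h = Suc (\<rho> m) \<and> (\<exists>q<length w. h + g = q \<and> w ! q = 2)))))))))
     = table w (\<rho> m) r (\<rho> i) (\<rho> j) (\<rho> l)"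
    unfolding e_def c_def by (auto simp: table_def Let_def)
qed

lemmas dec_intros = dec_not dec_and dec_or dec_imp dec_iff dec_ex_lt dec_all_lt dec_less dec_eq
  dec_Suc dec_const dec_add_const dec_double dec_double_Suc dec_table dec_sym dec_plus

section \<open>From programs to Turing machines\<close>

primrec marks_below :: "nat \<Rightarrow> cmd \<Rightarrow> bool" where
  "marks_below K MoveL = True"
| "marks_below K MoveR = True"
| "marks_below K (Put v) = (v < K)"
| "marks_below K (Del v) = True"
| "marks_below K (Seq c d) = (marks_below K c \<and> marks_below K d)"
| "marks_below K (Cond b c d) = (marks_below K c \<and> marks_below K d)"
| "marks_below K (While b c) = marks_below K c"

lemma marks_below_mono: "marks_below K c \<Longrightarrow> K \<le> K' \<Longrightarrow> marks_below K' c"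
  by (induction c) auto

lemma ex_marks_below: "\<exists>K. marks_below K c"
proof (induction c)
  case (Seq c d)
  then obtain K L where "marks_below K c" "marks_below L d" by blast
  then have "marks_below (max K L) (Seq c d)" by (auto intro: marks_below_mono)
  then show ?case ..
next
  case (Cond b c d)
  then obtain K L where "marks_below K c" "marks_below L d" by blast
  then have "marks_below (max K L) (Cond b c d)" by (auto intro: marks_below_mono)
  then show ?case ..
qed auto

text \<open>The control stacks that can occur while \<open>c\<close> is on top of \<open>ks\<close>; finiteness of this set is
  what makes a stack of commands usable as the state of a Turing machine.\<close>

primrec stacks :: "cmd \<Rightarrow> cmd list \<Rightarrow> cmd list set" where
  "stacks MoveL ks = {MoveL # ks}"
| "stacks MoveR ks = {MoveR # ks}"
| "stacks (Put v) ks = {Put v # ks}"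
| "stacks (Del v) ks = {Del v # ks}"
| "stacks (Seq c d) ks = insert (Seq c d # ks) (stacks c (d # ks) \<union> stacks d ks)"
| "stacks (Cond b c d) ks = insert (Cond b c d # ks) (stacks c ks \<union> stacks d ks)"
| "stacks (While b c) ks = insert (While b c # ks) (stacks c (While b c # ks))"

lemma finite_stacks: "finite (stacks c ks)"
  by (induction c arbitrary: ks) auto

lemma stacks_self: "c # ks \<in> stacks c ks"
  by (cases c) auto

text \<open>A step either stays inside the subcommand on top or uncovers its continuation, which is
  again in the set by \<open>stacks_self\<close>; only completion of the whole command leaves the
  set, with stack \<open>ks\<close>. The continuation has to vary in the induction.\<close>

lemma stacks_closed: "ks' \<in> stacks c ks \<Longrightarrow> fst (act ks' a) \<in> insert ks (stacks c ks)"
proof (induction c arbitrary: ks)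
  case (Seq c d)
  from Seq.prems consider "ks' = Seq c d # ks" | "ks' \<in> stacks c (d # ks)" | "ks' \<in> stacks d ks"
    by auto
  then show ?case
  proof cases
    case 1
    then show ?thesis using stacks_self[of c "d # ks"] by auto
  next
    case 2
    then show ?thesis using Seq.IH(1)[OF 2] stacks_self[of d ks] by auto
  next
    case 3
    then show ?thesis using Seq.IH(2)[OF 3] by auto
  qed
next
  case (Cond b c d)
  from Cond.prems consider "ks' = Cond b c d # ks" | "ks' \<in> stacks c ks" | "ks' \<in> stacks d ks"
    by auto
  then show ?case
  proof cases
    case 1
    then show ?thesis using stacks_self[of c ks] stacks_self[of d ks] by auto
  next
    case 2
    then show ?thesis using Cond.IH(1)[OF 2] by auto
  next
    case 3
    then show ?thesis using Cond.IH(2)[OF 3] by auto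
  qed
next
  case (While b c)
  from While.prems consider "ks' = While b c # ks" | "ks' \<in> stacks c (While b c # ks)"
    by auto
  then show ?case
  proof cases
    case 1
    then show ?thesis using stacks_self[of c "While b c # ks"] by auto
  next
    case 2
    then show ?thesis using While.IH[OF 2] by auto
  qed
qed auto

lemma stacks_marks:
  "ks' \<in> stacks c ks \<Longrightarrow> marks_below K c \<Longrightarrow> \<forall>d\<in>set ks. marks_below K d \<Longrightarrow> \<forall>d\<in>set ks'. marks_below K d"
proof (induction c arbitrary: ks)
  case (Seq c d)
  from Seq.prems(1) consider "ks' = Seq c d # ks" | "ks' \<in> stacks c (d # ks)" | "ks' \<in> stacks d ks"
    by auto
  then show ?case
  proof cases
    case 1
    then show ?thesis using Seq.prems(2,3) by simp
  next
    case 2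
    show ?thesis by (rule Seq.IH(1)[OF 2]) (use Seq.prems(2,3) in simp_all)
  next
    case 3
    show ?thesis by (rule Seq.IH(2)[OF 3]) (use Seq.prems(2,3) in simp_all)
  qed
next
  case (Cond b c d)
  from Cond.prems(1) consider "ks' = Cond b c d # ks" | "ks' \<in> stacks c ks" | "ks' \<in> stacks d ks"
    by auto
  then show ?case
  proof cases
    case 1
    then show ?thesis using Cond.prems(2,3) by simp
  next
    case 2
    show ?thesis by (rule Cond.IH(1)[OF 2]) (use Cond.prems(2,3) in simp_all)
  next
    case 3
    show ?thesis by (rule Cond.IH(2)[OF 3]) (use Cond.prems(2,3) in simp_all)
  qed
next
  case (While b c)
  from While.prems(1) consider "ks' = While b c # ks" | "ks' \<in> stacks c (While b c # ks)"
    by auto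
  then show ?case
  proof cases
    case 1
    then show ?thesis using While.prems(2,3) by simp
  next
    case 2
    show ?thesis by (rule While.IH[OF 2]) (use While.prems(2,3) in simp_all)
  qed
qed simp_all

text \<open>A cell without marks is coded by its own letter, so the initial tape of the Turing
  machine, blanks included, already is the coded tape.\<close>

definition code :: "cell \<Rightarrow> nat" where "code = (\<lambda>(a, S). a + 4 * set_encode S)"

definition decode :: "nat \<Rightarrow> cell" where "decode n = (n mod 4, set_decode (n div 4))"

definition cell_below :: "nat \<Rightarrow> cell \<Rightarrow> bool" where
  "cell_below K = (\<lambda>(a, S). a < 4 \<and> S \<subseteq> {..<K})"

lemma decode_code: "cell_below K a \<Longrightarrow> decode (code a) = a"
  by (auto simp: cell_below_def decode_def code_def finite_subset)

lemma code_below: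
  assumes "cell_below K a"
  shows "code a < 4 * 2 ^ K"
proof -
  obtain x S where a: "a = (x, S)" "x < 4" "S \<subseteq> {..<K}"
    using assms by (cases a) (auto simp: cell_below_def)
  have "set_encode S \<le> set_encode {..<K}"
    unfolding set_encode_def by (rule sum_mono2) (use a in auto)
  also have "\<dots> < 2 ^ K"
    by (induction K) (auto simp: lessThan_Suc)
  finally show ?thesis using a by (simp add: code_def)
qed

lemma decode_below:
  assumes "n < 4 * 2 ^ K"
  shows "cell_below K (decode n)"
proof -
  have "v < K" if "v \<in> set_decode (n div 4)" for v
  proof (rule ccontr)
    assume "\<not> v < K"
    then have "(2::nat) ^ K \<le> 2 ^ v" by (intro power_increasing) auto
    moreover have "n div 4 < 2 ^ K" using assms by (simp add: less_mult_imp_div_less mult.commute)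
    ultimately have "n div 4 < 2 ^ v" by linarith
    then show False using that by (simp add: set_decode_def)
  qed
  then show ?thesis by (auto simp: cell_below_def decode_def)
qed

lemma act_below:
  assumes "cell_below K a" "\<forall>d\<in>set ks. marks_below K d"
  shows "cell_below K (fst (snd (act ks a)))"
  using assms by (cases "(ks, a)" rule: act.cases) (auto simp: cell_below_def split: if_splits)

lemma act_move: "snd (snd (act ks a)) \<in> {-1, 0, 1}"
  by (cases "(ks, a)" rule: act.cases) auto

text \<open>The first claim about \<open>M\<close> carries a time bound, the second excludes wrong
  acceptance at any time. The simulation therefore follows the run up to its halting state and shows
  that the accepting state is not entered before.\<close>

lemma dec_tm:
  assumes "dec 0 P"
  obtains M f where "wf_tm M" "pbound f"
    "\<And>w. word w \<Longrightarrow> set w \<subseteq> {..<4} \<Longrightarrow> P w (\<lambda>_. 0) \<Longrightarrow> accepts_within M w (f (length w))"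
    "\<And>w t. word w \<Longrightarrow> set w \<subseteq> {..<4} \<Longrightarrow> accepts_within M w t \<Longrightarrow> P w (\<lambda>_. 0)"
proof -
  let ?\<rho> = "\<lambda>_::nat. 0::nat"
  obtain c f where f: "pbound f" and c: "\<And>w. word w \<Longrightarrow>
      exec w c (f (length w)) (env 0 ?\<rho>) 0 (flag (P w ?\<rho>) (env 0 ?\<rho>)) 0"
    using assms unfolding dec_def valid_def by auto
  obtain K where K: "marks_below K c" using ex_marks_below by blast
  define St where "St = insert [] (stacks c [])"
  have fin: "finite St" by (simp add: St_def finite_stacks)
  obtain g0 where g0: "bij_betw g0 St {..<card St}"
    using ex_bij_betw_finite_nat[OF fin] by (auto simp: atLeast0LessThan)
  \<comment> \<open>State 0 is the start and belongs to the initial stack \<open>[c]\<close>; 1 and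
    2 are the halting states, so all other stacks are numbered from 3 on.\<close>
  define g where "g s = (if s = [c] then 0 else g0 s + 3)" for s
  have ginj: "inj_on g St"
    using g0 by (auto simp: inj_on_def bij_betw_def g_def)
  have g12: "g s \<noteq> 1" "g s \<noteq> 2" for s by (auto simp: g_def)
  define Q where "Q = card St + 3"
  have gQ: "g s < Q" if "s \<in> St" for s
    using g0 that by (auto simp: g_def Q_def bij_betw_def)
  define \<delta> where "\<delta> q a =
     (if q = 1 \<or> q = 2 \<or> q \<notin> g ` St then (2, a, 0)
      else let s = inv_into St g q in
        if s = [] then (if 0 \<in> snd (decode a) then 1 else 2, a, 0)
        else (g (fst (act s (decode a))), code (fst (snd (act s (decode a)))), snd (snd (act s (decode a)))))"
    for q a
  define M where "M = (Q, 4 * 2 ^ K :: nat, \<delta>)"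
  have closed: "fst (act s a) \<in> St" if "s \<in> St" for s a
    using that stacks_closed[of s c "[]" a] by (auto simp: St_def)
  have marks: "\<forall>d\<in>set s. marks_below K d" if "s \<in> St" for s
    using that stacks_marks[of s c "[]" K] K by (auto simp: St_def)
  have wf: "wf_tm M"
  proof -
    have "fst (\<delta> q a) < Q \<and> fst (snd (\<delta> q a)) < 4 * 2 ^ K \<and> snd (snd (\<delta> q a)) \<in> {-1, 0, 1}"
      if q: "q < Q" and a: "a < 4 * 2 ^ K" for q a
    proof (cases "q = 1 \<or> q = 2 \<or> q \<notin> g ` St")
      case True
      then show ?thesis using a by (simp add: \<delta>_def Q_def)
    next
      case False
      then have s: "inv_into St g q \<in> St" by (simp add: inv_into_into)
      then show ?thesis using False a closed[OF s] gQ act_move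
          code_below[OF act_below[OF decode_below[OF a] marks[OF s]]]
        by (auto simp: \<delta>_def Q_def Let_def)
    qed
    moreover have "(4::nat) \<le> 4 * 2 ^ K" by simp
    ultimately show ?thesis by (simp add: wf_tm_def M_def Q_def)
  qed
  define img where "img = (\<lambda>(s, T, h :: int). (g s, code \<circ> T, h) :: tm_config)"
  have sim: "tm_step M (img (s, T, h)) = img (step (s, T, h))"
    if "s \<in> St" "s \<noteq> []" "\<And>i. cell_below K (T i)" for s T h
    using that g12[of s] ginj decode_code[OF that(3)]
    by (auto simp: tm_step_def M_def img_def \<delta>_def step_def Let_def fun_eq_iff
        split: prod.splits)
  have fin_step: "tm_step M (img ([], T, h)) = (if 0 \<in> snd (T h) then 1 else 2, code \<circ> T, h)"
    if "\<And>i. cell_below K (T i)" for T h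
    using that g12[of "[]"] ginj decode_code[OF that]
    by (auto simp: tm_step_def M_def img_def \<delta>_def St_def Let_def fun_eq_iff)
  have run: "\<exists>t0\<le>f (length w). \<exists>tp h.
      (\<forall>i\<le>t0. fst ((tm_step M ^^ i) (tm_init w)) \<noteq> 1) \<and>
      (\<forall>i. (tm_step M ^^ (Suc t0 + i)) (tm_init w) = (if P w ?\<rho> then 1 else 2, tp, h))"
    if w: "word w" "set w \<subseteq> {..<4}" for w
  proof -
    define start where "start = ([c], tape w (env 0 ?\<rho>), 0 :: int)"
    let ?E = "flag (P w ?\<rho>) (env 0 ?\<rho>)"
    obtain t where t: "t \<le> f (length w)" "(step ^^ t) start = ([], tape w ?E, 0)"
      using c[OF w(1)] unfolding exec_def start_def by blast
    \<comment> \<open>At the empty stack the machine halts whereas \<open>step\<close> idles, so the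
      simulation is valid up to the first such moment. As \<open>step\<close> changes nothing
      afterwards, the configuration reached then is already the one promised by
      \<open>exec\<close>.\<close>
    define t0 where "t0 = (LEAST i. fst ((step ^^ i) start) = [])"
    have t0: "fst ((step ^^ t0) start) = []"
      unfolding t0_def by (rule LeastI[of _ t]) (simp add: t)
    have le: "t0 \<le> t" unfolding t0_def by (rule Least_le) (simp add: t)
    have min: "fst ((step ^^ i) start) \<noteq> []" if "i < t0" for i
      using not_less_Least that unfolding t0_def by blast
    have stay: "(step ^^ i) ([], T, h) = ([], T, h)" for i T h
      by (induction i) (auto simp: step_def)
    have "(step ^^ t) start = (step ^^ (t - t0)) ((step ^^ t0) start)"
      using le by (metis funpow_add comp_apply le_add_diff_inverse2)
    then have end0: "(step ^^ t0) start = ([], tape w ?E, 0)"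
      using t0 t(2) stay by (metis prod.collapse)
    have inv: "(tm_step M ^^ i) (tm_init w) = img ((step ^^ i) start) \<and>
        fst ((step ^^ i) start) \<in> St \<and> (\<forall>j. cell_below K (fst (snd ((step ^^ i) start)) j))"
      if "i \<le> t0" for i
      using that
    proof (induction i)
      case 0
      have "w ! j < 4" if "j < length w" for j using w(2) nth_mem[OF that] by blast
      moreover have "[c] \<in> St" by (simp add: St_def stacks_self)
      ultimately show ?case
        by (auto simp: start_def img_def tm_init_def g_def tape_def env_def code_def fun_eq_iff cell_below_def)
    next
      case (Suc i)
      obtain s T h where e: "(step ^^ i) start = (s, T, h)" by (cases "(step ^^ i) start") auto
      have I: "(tm_step M ^^ i) (tm_init w) = img (s, T, h)" "s \<in> St" "\<And>j. cell_below K (T j)" "s \<noteq> []"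
        using Suc min[of i] e by auto
      have "fst (step (s, T, h)) \<in> St" using closed[OF I(2)]
        by (simp add: step_def split: prod.split) (metis fst_conv)
      moreover have "cell_below K (fst (snd (step (s, T, h))) j)" for j
        using act_below[OF I(3) marks[OF I(2)], of h] I(3)
        by (auto simp: step_def split: prod.split)
      ultimately show ?case using sim[OF I(2,4,3)] I(1) e by simp
    qed
    define z where "z = (if P w ?\<rho> then 1 else 2 :: nat, code \<circ> tape w ?E, 0 :: int)"
    have "(tm_step M ^^ (Suc t0 + i)) (tm_init w) = z" for i
    proof (induction i)
      case 0
      have "(tm_step M ^^ Suc t0) (tm_init w) = tm_step M (img ([], tape w ?E, 0))"
        using inv[of t0] end0 by simp
      also have "\<dots> = z"
        using inv[of t0] end0 by (subst fin_step) (auto simp: z_def tape_def flag_def)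
      finally show ?case by simp
    next
      case (Suc i)
      then show ?case by (simp add: z_def tm_step_def M_def)
    qed
    moreover have "fst ((tm_step M ^^ i) (tm_init w)) \<noteq> 1" if "i \<le> t0" for i
      using inv[OF that] g12 by (auto simp: img_def split: prod.splits)
    ultimately show ?thesis using le t(1) unfolding z_def by (intro exI[of _ t0]) (auto intro: order_trans)
  qed
  show thesis
  proof (rule that[OF wf pbound_add[OF f pbound_const[of 1]]])
    fix w assume w: "word w" "set w \<subseteq> {..<4}"
    from run[OF w] obtain t0 tp h where r: "t0 \<le> f (length w)"
      "\<And>i. i \<le> t0 \<Longrightarrow> fst ((tm_step M ^^ i) (tm_init w)) \<noteq> 1"
      "\<And>i. (tm_step M ^^ (Suc t0 + i)) (tm_init w) = (if P w ?\<rho> then 1 else 2, tp, h)"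
      by blast
    { assume "P w ?\<rho>"
      then show "accepts_within M w (f (length w) + 1)"
        using r(1) r(3)[of 0] unfolding accepts_within_def by (intro exI[of _ "Suc t0"]) simp }
    { fix t assume "accepts_within M w t"
      then obtain i where i: "fst ((tm_step M ^^ i) (tm_init w)) = 1"
        unfolding accepts_within_def by blast
      then have "t0 < i" using r(2)[of i] by (meson not_less)
      then obtain j where j: "i = Suc t0 + j" using less_iff_Suc_add by auto
      show "P w ?\<rho>" using i unfolding j r(3) by (simp split: if_splits) }
  qed
qed

section \<open>Flows and termination of Run\<close>

definition inflow :: "nat list \<Rightarrow> nat list \<Rightarrow> nat \<Rightarrow> (nat \<Rightarrow> nat) \<Rightarrow> nat \<Rightarrow> nat" where
  "inflow s0 s1 n t v = (\<Sum>u<n. if s0 ! u = v then (t u + 1) div 2 else 0)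
     + (\<Sum>u<n. if s1 ! u = v then t u div 2 else 0)"

lemma inflow_mono: "(\<And>u. u < n \<Longrightarrow> t u \<le> t' u) \<Longrightarrow> inflow s0 s1 n t v \<le> inflow s0 s1 n t' v"
  unfolding inflow_def by (intro add_mono sum_mono) (auto intro: div_le_mono)

lemma run_step_apply: "run_step (v, f, g) = (f v, f(v := g v), g(v := f v))"
  by (simp add: run_step_def)

locale switch_graph =
  fixes n :: nat and s0 s1 :: "nat list" and orig d :: nat
  assumes inst: "valid_instance n s0 s1 orig d"
begin

definition pos :: "nat \<Rightarrow> nat" where
  "pos k = fst ((run_step ^^ k) (run_init s0 s1 orig))"

text \<open>Counts departures, so the vertex occupied at time \<open>k\<close> is not included. The
  walk \<open>pos\<close> itself does not stop at \<open>d\<close>.\<close>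

definition visits :: "nat \<Rightarrow> nat \<Rightarrow> nat" where
  "visits k v = card {i. i < k \<and> pos i = v}"

lemma visits_0: "visits 0 v = 0"
  by (simp add: visits_def)

lemma visits_Suc: "visits (Suc k) v = visits k v + of_bool (v = pos k)"
proof -
  have "{i. i < Suc k \<and> pos i = v} = (if pos k = v then insert k {i. i < k \<and> pos i = v} else {i. i < k \<and> pos i = v})"
    by (auto simp: less_Suc_eq)
  then show ?thesis by (simp add: visits_def)
qed

text \<open>Every departure swaps the switch, so both arrays are determined by the parities of the
  counts. A configuration is thus a vertex with a set of odd vertices, which is the origin of the
  bound n * 2^n.\<close>

lemma run_state:
  "(run_step ^^ k) (run_init s0 s1 orig) =
    (pos k, (\<lambda>v. if even (visits k v) then s0 ! v else s1 ! v), (\<lambda>v. if even (visits k v) then s1 ! v else s0 ! v))"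
proof (induction k)
  case 0
  show ?case by (simp add: pos_def run_init_def visits_0)
next
  case (Suc k)
  have *: "(run_step ^^ Suc k) (run_init s0 s1 orig) = run_step (pos k,
      (\<lambda>v. if even (visits k v) then s0 ! v else s1 ! v), (\<lambda>v. if even (visits k v) then s1 ! v else s0 ! v))"
    by (simp only: funpow.simps comp_apply Suc)
  have p: "pos (Suc k) = (if even (visits k (pos k)) then s0 ! pos k else s1 ! pos k)"
    unfolding pos_def[of "Suc k"] * by (simp add: run_step_apply)
  show ?case unfolding * p by (auto simp: run_step_apply visits_Suc fun_eq_iff)
qed

lemma pos_Suc: "pos (Suc k) = (if even (visits k (pos k)) then s0 ! pos k else s1 ! pos k)"
proof -
  have "pos (Suc k) = fst (run_step ((run_step ^^ k) (run_init s0 s1 orig)))"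
    by (simp add: pos_def)
  then show ?thesis by (simp add: run_state run_step_apply)
qed

lemma pos_0: "pos 0 = orig"
  by (simp add: pos_def run_init_def)

lemma pos_less: "pos k < n"
  using inst by (induction k) (auto simp: pos_0 pos_Suc valid_instance_def)

text \<open>Token conservation: whatever started at or came to \<open>v\<close> has left it again or
  is there now. The strict alternation of the switch makes \<open>inflow\<close> the number of
  arrivals.\<close>

lemma inflow_visits: "of_bool (v = orig) + inflow s0 s1 n (visits k) v = visits k v + of_bool (v = pos k)"
proof (induction k)
  case 0
  show ?case by (simp add: visits_0 inflow_def pos_0 cong: if_cong)
next
  case (Suc k)
  \<comment> \<open>One more departure from \<open>pos k\<close> raises the ceiling of half the
    count exactly if the count was even and, in the sum after this one, the floor exactly if it was
    odd.\<close>
  have s0: "(\<Sum>u<n. if s0 ! u = v then (visits (Suc k) u + 1) div 2 else 0) =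
     (\<Sum>u<n. if s0 ! u = v then (visits k u + 1) div 2 else 0) +
     (\<Sum>u<n. if u = pos k then of_bool (s0 ! u = v \<and> even (visits k u)) else 0)"
    unfolding sum.distrib[symmetric] by (rule sum.cong) (auto simp: visits_Suc elim!: evenE oddE)
  have s1: "(\<Sum>u<n. if s1 ! u = v then visits (Suc k) u div 2 else 0) =
     (\<Sum>u<n. if s1 ! u = v then visits k u div 2 else 0) +
     (\<Sum>u<n. if u = pos k then of_bool (s1 ! u = v \<and> odd (visits k u)) else 0)"
    unfolding sum.distrib[symmetric] by (rule sum.cong) (auto simp: visits_Suc elim!: evenE oddE)
  have "inflow s0 s1 n (visits (Suc k)) v = inflow s0 s1 n (visits k) v + of_bool (v = pos (Suc k))"
    using pos_less[of k] by (auto simp: inflow_def s0 s1 pos_Suc)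
  then show ?case using Suc.IH by (simp add: visits_Suc[of k v])
qed

lemma sum_visits: "(\<Sum>v<n. visits k v) = k"
proof (induction k)
  case (Suc k)
  have "(\<Sum>v<n. of_bool (v = pos k)) = (\<Sum>v<n. if v = pos k then 1 else 0 :: nat)"
    by (rule sum.cong) auto
  then show ?case using Suc pos_less[of k] by (simp add: visits_Suc sum.distrib)
qed (simp add: visits_0)

lemma flow_imp_terminates:
  assumes t: "\<And>v. v < n \<Longrightarrow> v \<noteq> d \<Longrightarrow> of_bool (v = orig) + inflow s0 s1 n t v = t v"
  shows "run_terminates s0 s1 orig d"
proof (rule ccontr)
  assume "\<not> run_terminates s0 s1 orig d"
  then have nd: "pos k \<noteq> d" for k by (auto simp: run_terminates_def pos_def)
  have le: "\<forall>v<n. visits k v \<le> t v" for k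
  proof (induction k)
    case (Suc k)
    let ?u = "pos k"
    \<comment> \<open>With the token on \<open>?u\<close>, conservation for the run, monotonicity of
      \<open>inflow\<close> and the law for \<open>t\<close> give
      \<open>visits k ?u + 1 \<le> t ?u\<close>. So there is always room for the next
      departure.\<close>
    have "visits k ?u \<noteq> t ?u"
    proof
      assume e: "visits k ?u = t ?u"
      have "inflow s0 s1 n (visits k) ?u \<le> inflow s0 s1 n t ?u"
        by (rule inflow_mono) (use Suc in auto)
      then show False
        using inflow_visits[of ?u k] t[OF pos_less nd, of k] e by simp
    qed
    then have "visits k ?u < t ?u" using Suc pos_less[of k] by (simp add: le_neq_implies_less)
    then show ?case using Suc by (auto simp: visits_Suc)
  qed (simp add: visits_0)
  have "k \<le> (\<Sum>v<n. t v)" for k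
    using sum_mono[of "{..<n}" "visits k" t] le[of k] by (simp add: sum_visits)
  from this[of "Suc (\<Sum>v<n. t v)"] show False by simp
qed

lemma terminates_bound:
  assumes "run_terminates s0 s1 orig d"
  obtains k where "pos k = d" "k < n * 2 ^ n"
proof -
  define k where "k = (LEAST k. pos k = d)"
  have k: "pos k = d"
    using assms unfolding k_def run_terminates_def pos_def by (rule LeastI_ex)
  have min: "pos i \<noteq> d" if "i < k" for i
    using not_less_Least that unfolding k_def by blast
  define key where "key i = (pos i, {v. odd (visits i v)})" for i
  have zero: "visits i v = 0" if "v \<ge> n" for i v
    using that pos_less by (auto simp: visits_def card_eq_0_iff) (metis not_less)
  \<comment> \<open>If two configurations agreed, leaving out the steps between them would bring the
    walk to \<open>d\<close> at time \<open>k - (j - i)\<close>, against the minimality of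
    \<open>k\<close>.\<close>
  have inj: "key i \<noteq> key j" if ij: "i < j" "j \<le> k" for i j
  proof
    assume "key i = key j"
    then have "pos i = pos j" "\<And>v. odd (visits i v) \<longleftrightarrow> odd (visits j v)" by (auto simp: key_def)
    then have e: "(run_step ^^ i) (run_init s0 s1 orig) = (run_step ^^ j) (run_init s0 s1 orig)"
      by (auto simp: run_state fun_eq_iff)
    have "(run_step ^^ (k - j + i)) (run_init s0 s1 orig) = (run_step ^^ (k - j + j)) (run_init s0 s1 orig)"
      by (simp only: funpow_add comp_apply e)
    then have "pos (k - j + i) = pos k" using ij by (simp add: pos_def)
    moreover have "k - j + i < k" using ij by linarith
    ultimately show False using min k by metis
  qed
  have "inj_on key {..k}"
    by (rule inj_onI) (metis inj atMost_iff linorder_neqE_nat)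
  moreover have "key ` {..k} \<subseteq> {..<n} \<times> Pow {..<n}"
    using pos_less zero by (auto simp: key_def) (metis even_zero not_less)
  ultimately have "card {..k} \<le> card ({..<n} \<times> Pow {..<n})"
    by (intro card_inj_on_le) auto
  then have "k < n * 2 ^ n" by (simp add: card_Pow)
  with k show thesis by (rule that)
qed

lemma terminates_imp_flow:
  assumes "run_terminates s0 s1 orig d"
  obtains t where "\<And>v. v \<noteq> d \<Longrightarrow> of_bool (v = orig) + inflow s0 s1 n t v = t v"
    and "(\<Sum>v<n. t v) < n * 2 ^ n"
proof -
  obtain k where k: "pos k = d" "k < n * 2 ^ n" using assms by (rule terminates_bound)
  have f: "of_bool (v = orig) + inflow s0 s1 n (visits k) v = visits k v" if "v \<noteq> d" for v
    using inflow_visits[of v k] that k by simp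
  show thesis by (rule that[OF f]) (simp_all add: sum_visits k)
qed

end

section \<open>Binary addition with carries\<close>

primrec carry :: "nat \<Rightarrow> nat \<Rightarrow> bool \<Rightarrow> nat \<Rightarrow> bool" where
  "carry x y c 0 = c"
| "carry x y c (Suc b) = (odd (x div 2 ^ b) \<and> odd (y div 2 ^ b) \<or>
     carry x y c b \<and> (odd (x div 2 ^ b) \<or> odd (y div 2 ^ b)))"

text \<open>\<open>carry x y c b\<close> is the carry into bit \<open>b\<close> of ripple-carry
  addition with initial carry \<open>c\<close>, and cutting off the low \<open>b\<close> bits of the
  summands loses exactly this carry. Parities of the quotients give the sum bits; a vanishing
  quotient shows that no carry leaves a sum that fits into \<open>b\<close> bits.\<close>

lemma carry_div: "(x + y + of_bool c) div 2 ^ b = x div 2 ^ b + y div 2 ^ b + of_bool (carry x y c b)"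
proof (induction b)
  case (Suc b)
  have d: "u div 2 ^ Suc b = u div 2 ^ b div 2" for u :: nat
    by (simp only: power_Suc2 div_mult2_eq)
  show ?case unfolding d Suc
    by (cases "even (x div 2 ^ b)"; cases "even (y div 2 ^ b)"; cases "carry x y c b")
      (auto elim!: evenE oddE)
qed simp

lemma carry_bit:
  "odd ((x + y + of_bool c) div 2 ^ b) \<longleftrightarrow> ((odd (x div 2 ^ b) \<longleftrightarrow> odd (y div 2 ^ b)) \<longleftrightarrow> carry x y c b)"
  unfolding carry_div by auto

lemma carry_top: "x + y + of_bool c < 2 ^ b \<Longrightarrow> \<not> carry x y c b"
  using carry_div[of x y c b] by (auto split: if_splits)

definition val :: "nat \<Rightarrow> (nat \<Rightarrow> bool) \<Rightarrow> nat" where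
  "val B f = (\<Sum>b<B. of_bool (f b) * 2 ^ b)"

text \<open>The premises say that a sum bit plus twice the next carry equals the two summand bits
  plus the current carry. Weighted by \<open>2 ^ b\<close> and added up, the carries
  telescope.\<close>

lemma val_add:
  assumes "\<And>b. b < B \<Longrightarrow> q' b \<longleftrightarrow> ((q b \<longleftrightarrow> a b) \<longleftrightarrow> c b)"
    and "\<And>b. b < B \<Longrightarrow> c (Suc b) \<longleftrightarrow> q b \<and> a b \<or> c b \<and> (q b \<or> a b)"
  shows "val B q' + of_bool (c B) * 2 ^ B = val B q + val B a + of_bool (c 0)"
  using assms
proof (induction B)
  case (Suc B)
  have "val B q' + of_bool (c B) * 2 ^ B = val B q + val B a + of_bool (c 0)"
    by (rule Suc.IH) (use Suc.prems in auto)
  then show ?case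
    using Suc.prems[of B] by (auto simp: val_def)
qed (simp add: val_def)

lemma val_Suc_shift: "val (Suc B) f = of_bool (f 0) + 2 * val B (\<lambda>b. f (Suc b))"
  unfolding val_def sum.lessThan_Suc_shift by (simp add: sum_distrib_left mult_ac del: sum_of_bool_mult_eq)

lemma val_cong: "(\<And>b. b < B \<Longrightarrow> f b = g b) \<Longrightarrow> val B f = val B g"
  unfolding val_def by (rule sum.cong) auto

section \<open>The certificate\<close>

text \<open>Here P p j v means that a suffix of the code of number j, itself the code of v, starts at
  position p, and N j v that number j of the input is v. Auxiliary variables such as q name the
  successors of positions, since the atoms of the decision procedure only mention variables.\<close>

definition parse_ok ::
  "nat \<Rightarrow> nat \<Rightarrow> (nat \<Rightarrow> bool) \<Rightarrow> (nat \<Rightarrow> nat \<Rightarrow> nat \<Rightarrow> bool) \<Rightarrow> (nat \<Rightarrow> nat \<Rightarrow> bool) \<Rightarrow> bool" where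
  "parse_ok m J X P N \<longleftrightarrow> (\<forall>p<m. \<forall>j<m. \<forall>v<m. P p j v \<longrightarrow> (\<exists>q<m. q = Suc p \<and>
     ((X p \<longleftrightarrow> X q) \<and> \<not> v = 0 \<and> (\<exists>r<m. r = Suc q \<and> (\<exists>u<m. P r j u \<and>
         (X p \<and> v = Suc (2 * u) \<or> \<not> X p \<and> v = 2 * u)))
      \<or> \<not> X p \<and> X q \<and> v = 0 \<and> (m = Suc q \<and> J = Suc j \<or>
         (\<exists>i<J. i = Suc j \<and> (\<exists>r<m. r = Suc q \<and> (\<exists>u<m. N i u \<and> P r i u)))))))"

text \<open>T u b is bit b of the flow out of u, Q v s b bit b of the flow into v from the first s edges
  together with the initial token at orig,
  and C v s b the carry into bit b when edge s is added. Edges s < n are the s_0-edges and the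
  edges n + u the s_1-edges; the target of edge s is number s + 3 of the input. The addend of an edge
  from u is T u shifted by one bit, where an s_0-edge rounds up by means of an initial carry.\<close>

definition flow_ok ::
  "nat \<Rightarrow> nat \<Rightarrow> nat \<Rightarrow> nat \<Rightarrow> nat \<Rightarrow> nat \<Rightarrow> (nat \<Rightarrow> nat \<Rightarrow> bool) \<Rightarrow> (nat \<Rightarrow> nat \<Rightarrow> bool) \<Rightarrow>
   (nat \<Rightarrow> nat \<Rightarrow> nat \<Rightarrow> bool) \<Rightarrow> (nat \<Rightarrow> nat \<Rightarrow> nat \<Rightarrow> bool) \<Rightarrow> bool" where
  "flow_ok m n n2 orig d z N T Q C \<longleftrightarrow>
    (\<forall>v<n. \<forall>b<m. Q v z b \<longleftrightarrow> b = z \<and> v = orig) \<and>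
    (\<forall>u<n. \<forall>b<m. m = Suc b \<longrightarrow> \<not> T u b) \<and>
    (\<forall>v<n. \<forall>s<n2. \<exists>u<n. \<exists>j<m. \<exists>i<m. j = s + 3 \<and> i = Suc s \<and> (s = u \<or> u + n = s) \<and>
      (C v s z \<longleftrightarrow> N j v \<and> s < n \<and> T u z) \<and>
      (\<forall>b<m. m = Suc b \<longrightarrow> \<not> C v s b) \<and>
      (\<forall>b<m. \<forall>c<m. c = Suc b \<longrightarrow>
        (Q v i b \<longleftrightarrow> ((Q v s b \<longleftrightarrow> N j v \<and> T u c) \<longleftrightarrow> C v s b)) \<and>
        (C v s c \<longleftrightarrow> Q v s b \<and> N j v \<and> T u c \<or> C v s b \<and> (Q v s b \<or> N j v \<and> T u c)))) \<and>
    (\<forall>v<n. \<not> v = d \<longrightarrow> (\<forall>b<m. \<forall>c<m. c = Suc b \<longrightarrow> (Q v n2 b \<longleftrightarrow> T v b)))"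

definition cert_ok :: "nat list \<Rightarrow> bool" where
  "cert_ok w \<longleftrightarrow> (\<exists>m<length w. w ! m = 3 \<and> (\<exists>n<m. \<exists>orig<n. \<exists>d<n. \<exists>n2<m. \<exists>J<m. \<exists>z<m. \<exists>e1<m. \<exists>e2<m.
     z = 0 \<and> e1 = 1 \<and> e2 = 2 \<and> n2 = 2 * n \<and> J = n2 + 3 \<and>
     table w m 1 z n z \<and> table w m 1 e1 orig z \<and> table w m 1 e2 d z \<and> table w m 0 z z n \<and>
     (\<forall>j<J. \<forall>v<m. \<forall>u<m. table w m 1 j v z \<and> table w m 1 j u z \<longrightarrow> v = u) \<and>
     (\<forall>j<J. e2 < j \<longrightarrow> (\<exists>v<n. table w m 1 j v z)) \<and>
     parse_ok m J (\<lambda>p. w ! p = 2) (table w m 0) (\<lambda>j v. table w m 1 j v z) \<and>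
     flow_ok m n n2 orig d z (\<lambda>j v. table w m 1 j v z) (\<lambda>u b. table w m 2 u b z)
       (table w m 3) (table w m 4)))"

lemma dec_cert_ok: "dec 0 (\<lambda>w \<rho>. cert_ok w)"
  unfolding cert_ok_def parse_ok_def flow_ok_def
  by (rule dec_ex, intro dec_intros) simp_all

lemma enc_num_0: "enc_num 0 = [False, True]"
  by (simp add: enc_num_def)

lemma enc_num_pos: "v \<noteq> 0 \<Longrightarrow> enc_num v = odd v # odd v # enc_num (v div 2)"
  unfolding enc_num_def by (subst bin.simps) simp

declare bin.simps [simp del]

text \<open>The condition at \<open>p\<close> accounts for two letters and refers only to a claim at
  \<open>p + 2\<close>, so claims cannot support each other in a circle and induction on the
  remaining length applies. \<open>nm\<close> turns the relation \<open>N\<close> into a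
  function.\<close>

lemma parse_sound:
  assumes ok: "parse_ok (length x) J X P N" and X: "\<And>p. p < length x \<Longrightarrow> X p = x ! p"
    and J: "J \<le> length x"
    and nm: "\<And>i u. i < J \<Longrightarrow> u < length x \<Longrightarrow> N i u \<Longrightarrow> nm i = u"
    and "P p j v" "p < length x" "j < J" "v < length x"
  shows "drop p x = enc_num v @ concat (map enc_num (map nm [Suc j..<J]))"
  using assms(5-)
proof (induction "length x - p" arbitrary: p j v rule: less_induct)
  case less
  let ?m = "length x" and ?q = "Suc p"
  have j: "j < ?m" using less.prems J by simp
  from ok less.prems j have q: "?q < ?m" and
    cs: "(X p \<longleftrightarrow> X ?q) \<and> v \<noteq> 0 \<and> Suc ?q < ?m \<and> (\<exists>u<?m. P (Suc ?q) j u \<and>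
         (X p \<and> v = Suc (2 * u) \<or> \<not> X p \<and> v = 2 * u))
      \<or> \<not> X p \<and> X ?q \<and> v = 0 \<and> (?m = Suc ?q \<and> J = Suc j \<or>
         Suc j < J \<and> Suc ?q < ?m \<and> (\<exists>u<?m. N (Suc j) u \<and> P (Suc ?q) (Suc j) u))"
    unfolding parse_ok_def by blast+
  have dr: "drop p x = X p # X ?q # drop (Suc ?q) x"
    using less.prems(2) q by (simp add: Cons_nth_drop_Suc X)
  from cs show ?case
  proof (elim disjE)
    assume a: "(X p \<longleftrightarrow> X ?q) \<and> v \<noteq> 0 \<and> Suc ?q < ?m \<and> (\<exists>u<?m. P (Suc ?q) j u \<and>
         (X p \<and> v = Suc (2 * u) \<or> \<not> X p \<and> v = 2 * u))"
    then obtain u where u: "u < ?m" "P (Suc ?q) j u" "X p \<and> v = Suc (2 * u) \<or> \<not> X p \<and> v = 2 * u"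
      by blast
    have "drop (Suc ?q) x = enc_num u @ concat (map enc_num (map nm [Suc j..<J]))"
      by (rule less.hyps) (use less.prems a u in auto)
    moreover have "enc_num v = X p # X ?q # enc_num u"
      using a u by (subst enc_num_pos) auto
    ultimately show ?case by (simp add: dr)
  next
    assume a: "\<not> X p \<and> X ?q \<and> v = 0 \<and> (?m = Suc ?q \<and> J = Suc j \<or>
         Suc j < J \<and> Suc ?q < ?m \<and> (\<exists>u<?m. N (Suc j) u \<and> P (Suc ?q) (Suc j) u))"
    then consider "?m = Suc ?q" "J = Suc j"
      | u where "Suc j < J" "Suc ?q < ?m" "u < ?m" "N (Suc j) u" "P (Suc ?q) (Suc j) u" by blast
    then show ?case
    proof cases
      case 1
      then show ?thesis using a by (simp add: dr enc_num_0)
    next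
      case 2
      have "drop (Suc ?q) x = enc_num u @ concat (map enc_num (map nm [Suc (Suc j)..<J]))"
        by (rule less.hyps) (use less.prems 2 in auto)
      moreover have "nm (Suc j) = u" using 2 nm by blast
      ultimately show ?thesis using a 2(1) by (simp add: dr enc_num_0 upt_conv_Cons)
    qed
  qed
qed

text \<open>Here \<open>P\<close> is the exact truth about suffixes of \<open>x\<close>. Such a
  suffix starts with a doubled bit if \<open>v\<close> is nonzero and with the end marker otherwise;
  removing this pair leaves a suffix of the same kind, or nothing after the last number.\<close>

lemma parse_complete:
  assumes x: "x = concat (map enc_num L)" and L: "\<And>i. i < length L \<Longrightarrow> L ! i < length x"
    and X: "\<And>p. p < length x \<Longrightarrow> X p = x ! p"
    and J: "J = length L" "J \<le> length x"
    and N: "\<And>j v. j < length x \<Longrightarrow> v < length x \<Longrightarrow> N j v \<longleftrightarrow> j < J \<and> v = L ! j"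
    and P: "\<And>p j v. p < length x \<Longrightarrow> j < length x \<Longrightarrow> v < length x \<Longrightarrow>
      P p j v \<longleftrightarrow> j < J \<and> drop p x = enc_num v @ concat (map enc_num (drop (Suc j) L))"
  shows "parse_ok (length x) J X P N"
  unfolding parse_ok_def
proof (intro allI impI)
  fix p j v
  let ?m = "length x" and ?q = "Suc p" and ?r = "Suc (Suc p)"
  assume b: "p < ?m" "j < ?m" "v < ?m" and "P p j v"
  then have j: "j < J" and d: "drop p x = enc_num v @ concat (map enc_num (drop (Suc j) L))"
    using P by auto
  obtain a c rest where e: "enc_num v = a # c # rest"
    using enc_num_0 enc_num_pos by (cases "v = 0") auto
  have "length (drop p x) \<ge> 2" unfolding d e by simp
  then have q: "?q < ?m" by simp
  have "drop p x = x ! p # x ! ?q # drop ?r x"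
    using b(1) q by (simp add: Cons_nth_drop_Suc)
  then have xs: "X p = a" "X ?q = c" and r: "drop ?r x = rest @ concat (map enc_num (drop (Suc j) L))"
    using d e X b(1) q by auto
  have ne: "enc_num u \<noteq> []" for u by (simp add: enc_num_def)
  have "((X p \<longleftrightarrow> X ?q) \<and> \<not> v = 0 \<and> (?r < ?m \<and> (\<exists>u<?m. P ?r j u \<and>
         (X p \<and> v = Suc (2 * u) \<or> \<not> X p \<and> v = 2 * u)))
      \<or> \<not> X p \<and> X ?q \<and> v = 0 \<and> (?m = ?r \<and> J = Suc j \<or>
         (Suc j < J \<and> ?r < ?m \<and> (\<exists>u<?m. N (Suc j) u \<and> P ?r (Suc j) u))))"
  proof (cases "v = 0")
    case False
    then have *: "a = odd v" "c = odd v" "rest = enc_num (v div 2)"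
      using e enc_num_pos[OF False] by auto
    have rm: "?r < ?m" using r ne unfolding * by (metis Nil_is_append_conv drop_all not_less)
    have "P ?r j (v div 2)" using P[OF rm b(2)] b(3) j r * by simp
    moreover have "v div 2 < ?m" using b(3) by simp
    moreover have "X p \<and> v = Suc (2 * (v div 2)) \<or> \<not> X p \<and> v = 2 * (v div 2)"
      unfolding xs * by presburger
    ultimately show ?thesis using xs * rm False by blast
  next
    case True
    then have *: "a = False" "c = True" "rest = []" using e enc_num_0 by auto
    show ?thesis
    proof (cases "Suc j < J")
      case False
      then have "Suc j = J" using j by simp
      then have "drop ?r x = []" using r * J by simp
      then have "?m = ?r" using q by simp
      then show ?thesis using xs * True \<open>Suc j = J\<close> by simp
    next
      case sj: True
      have r': "drop ?r x = enc_num (L ! Suc j) @ concat (map enc_num (drop (Suc (Suc j)) L))"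
        using r * sj J by (simp add: Cons_nth_drop_Suc[symmetric])
      have rm: "?r < ?m" using r' ne by (metis Nil_is_append_conv drop_all not_less)
      have sjm: "Suc j < ?m" and Lm: "L ! Suc j < ?m" using sj J L by auto
      show ?thesis using xs * True sj rm Lm P[OF rm sjm Lm] N[OF sjm Lm] r' by blast
    qed
  qed
  then show "\<exists>q<?m. q = Suc p \<and> ((X p \<longleftrightarrow> X q) \<and> \<not> v = 0 \<and> (\<exists>r<?m. r = Suc q \<and> (\<exists>u<?m. P r j u \<and>
         (X p \<and> v = Suc (2 * u) \<or> \<not> X p \<and> v = 2 * u)))
      \<or> \<not> X p \<and> X q \<and> v = 0 \<and> (?m = Suc q \<and> J = Suc j \<or>
         (\<exists>i<J. i = Suc j \<and> (\<exists>r<?m. r = Suc q \<and> (\<exists>u<?m. N i u \<and> P r i u)))))"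
    using q by blast
qed

section \<open>The flow condition as a chain of additions over the edges\<close>

definition edge_flow :: "nat list \<Rightarrow> nat list \<Rightarrow> nat \<Rightarrow> (nat \<Rightarrow> nat) \<Rightarrow> nat \<Rightarrow> nat \<Rightarrow> nat" where
  "edge_flow s0 s1 n t v s =
     (if s < n then (if s0 ! s = v then (t s + 1) div 2 else 0)
      else if s1 ! (s - n) = v then t (s - n) div 2 else 0)"

lemma sum_edge_flow: "(\<Sum>s<2 * n. edge_flow s0 s1 n t v s) = inflow s0 s1 n t v"
proof -
  have "(\<Sum>s<2 * n. edge_flow s0 s1 n t v s) =
      (\<Sum>s<n. edge_flow s0 s1 n t v s) + (\<Sum>s<n. edge_flow s0 s1 n t v (s + n))"
    by (subst sum.atLeastLessThan_concat[of 0 n "2 * n", simplified atLeast0LessThan, symmetric])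
      (auto simp: sum.shift_bounds_nat_ivl[of _ 0 n n, simplified] atLeast0LessThan mult_2)
  then show ?thesis by (simp add: inflow_def edge_flow_def cong: if_cong)
qed

lemma flow_sound:
  assumes ok: "flow_ok m n (2 * n) orig d 0 N T Q C"
    and m: "m = Suc B" "0 < B" "n < m" "2 * n < m"
    and N0: "\<And>u v. u < n \<Longrightarrow> v < n \<Longrightarrow> N (u + 3) v \<longleftrightarrow> s0 ! u = v"
    and N1: "\<And>u v. u < n \<Longrightarrow> v < n \<Longrightarrow> N (u + n + 3) v \<longleftrightarrow> s1 ! u = v"
    and v: "v < n" "v \<noteq> d"
  shows "of_bool (v = orig) + inflow s0 s1 n (\<lambda>u. val m (T u)) v = val m (T v)"
proof -
  define t where "t u = val m (T u)" for u
  have q0: "\<And>b. b < m \<Longrightarrow> Q v 0 b \<longleftrightarrow> b = 0 \<and> v = orig"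
    and top: "\<not> T v B"
    and fin: "\<And>b. b < B \<Longrightarrow> Q v (2 * n) b \<longleftrightarrow> T v b"
    using ok v m unfolding flow_ok_def by auto
  have t: "t u = of_bool (T u 0) + 2 * val B (\<lambda>b. T u (Suc b))" for u
    unfolding t_def m(1) by (rule val_Suc_shift)
  \<comment> \<open>Partial sums have only \<open>B = m - 1\<close> bits because every addend is
    shifted: its bit \<open>b\<close> is bit \<open>b + 1\<close> of \<open>T u\<close>.\<close>
  have "val B (Q v s) = of_bool (v = orig) + (\<Sum>s'<s. edge_flow s0 s1 n t v s')" if "s \<le> 2 * n" for s
    using that
  proof (induction s)
    case 0
    obtain B' where B': "B = Suc B'" using m(2) by (cases B) auto
    have "val B (Q v 0) = val B (\<lambda>b. b = 0 \<and> v = orig)"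
      by (rule val_cong) (use q0 m in auto)
    also have "\<dots> = of_bool (v = orig)"
      unfolding B' val_Suc_shift by (simp add: val_def)
    finally show ?case by simp
  next
    case (Suc s)
    then have s: "s < 2 * n" by simp
    have "\<forall>v<n. \<forall>s<2 * n. \<exists>u<n. \<exists>j<m. \<exists>i<m. j = s + 3 \<and> i = Suc s \<and> (s = u \<or> u + n = s) \<and>
      (C v s 0 \<longleftrightarrow> N j v \<and> s < n \<and> T u 0) \<and>
      (\<forall>b<m. m = Suc b \<longrightarrow> \<not> C v s b) \<and>
      (\<forall>b<m. \<forall>c<m. c = Suc b \<longrightarrow>
        (Q v i b \<longleftrightarrow> ((Q v s b \<longleftrightarrow> N j v \<and> T u c) \<longleftrightarrow> C v s b)) \<and>
        (C v s c \<longleftrightarrow> Q v s b \<and> N j v \<and> T u c \<or> C v s b \<and> (Q v s b \<or> N j v \<and> T u c)))"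
      using ok unfolding flow_ok_def by (elim conjE)
    from this[rule_format, OF v(1) s] obtain u j i where ji: "j = s + 3" "i = Suc s"
      and u: "u < n" "s = u \<or> u + n = s"
      and c0: "C v s 0 \<longleftrightarrow> N j v \<and> s < n \<and> T u 0"
      and cB: "\<forall>b<m. m = Suc b \<longrightarrow> \<not> C v s b"
      and ad: "\<forall>b<m. \<forall>c<m. c = Suc b \<longrightarrow>
        (Q v i b \<longleftrightarrow> ((Q v s b \<longleftrightarrow> N j v \<and> T u c) \<longleftrightarrow> C v s b)) \<and>
        (C v s c \<longleftrightarrow> Q v s b \<and> N j v \<and> T u c \<or> C v s b \<and> (Q v s b \<or> N j v \<and> T u c))"
      by (elim exE conjE)
    note c0 = c0[unfolded ji] and ad = ad[unfolded ji]
    have cB: "\<not> C v s B" using cB m(1) by simp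
    have add: "Q v (Suc s) b \<longleftrightarrow> ((Q v s b \<longleftrightarrow> N (s + 3) v \<and> T u (Suc b)) \<longleftrightarrow> C v s b)"
        "C v s (Suc b) \<longleftrightarrow> Q v s b \<and> (N (s + 3) v \<and> T u (Suc b))
           \<or> C v s b \<and> (Q v s b \<or> (N (s + 3) v \<and> T u (Suc b)))" if "b < B" for b
      using ad[rule_format, of b "Suc b"] that m(1) by auto
    have "val B (Q v (Suc s)) = val B (Q v s) + val B (\<lambda>b. N (s + 3) v \<and> T u (Suc b)) + of_bool (C v s 0)"
      using val_add[of B "Q v (Suc s)" "Q v s" "\<lambda>b. N (s + 3) v \<and> T u (Suc b)" "C v s", OF add] cB by simp
    moreover have "val B (\<lambda>b. N (s + 3) v \<and> T u (Suc b)) = (if N (s + 3) v then t u div 2 else 0)"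
      unfolding t by (simp add: val_def)
    \<comment> \<open>Since \<open>(t u + 1) div 2 = t u div 2 + t u mod 2\<close>, the lowest bit
      of \<open>t u\<close> enters as initial carry on an s_0-edge and is dropped on an
      s_1-edge.\<close>
    moreover have "(if N (s + 3) v then t u div 2 else 0) + of_bool (C v s 0) = edge_flow s0 s1 n t v s"
    proof (cases "s < n")
      case True
      then have "s = u" using u by auto
      then show ?thesis using True N0[OF u(1) v(1)] c0 unfolding edge_flow_def t by auto
    next
      case False
      then have "u + n = s" using u by auto
      then show ?thesis using False N1[OF u(1) v(1)] c0 unfolding edge_flow_def t by auto
    qed
    ultimately show ?case using Suc by simp
  qed
  from this[of "2 * n"] have "val B (Q v (2 * n)) = of_bool (v = orig) + inflow s0 s1 n t v"
    by (simp add: sum_edge_flow)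
  moreover have "val B (Q v (2 * n)) = val B (T v)" by (rule val_cong) (rule fin)
  \<comment> \<open>\<open>fin\<close> compares only the low \<open>B\<close> bits; the cleared top
    bit of \<open>T v\<close> turns this into an equality of numbers.\<close>
  moreover have "t v = val B (T v)" using top by (simp add: t_def m(1) val_def)
  ultimately show ?thesis unfolding t_def by simp
qed

text \<open>With the true partial sums in \<open>Q\<close> and their ripple carries in
  \<open>C\<close>, every local condition is one step of the addition algorithm; the bounds
  \<open>small\<close> make the top bits and the last carries vanish.\<close>

lemma flow_complete:
  fixes t :: "nat \<Rightarrow> nat" and n orig :: nat and s0 s1 :: "nat list"
  defines "S v s \<equiv> of_bool (v = orig) + (\<Sum>s'<s. edge_flow s0 s1 n t v s')"
  defines "src s \<equiv> (if s < n then s else s - n)"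
  defines "hit s v \<equiv> (if s < n then s0 ! s else s1 ! (s - n)) = v"
  assumes m: "m = Suc B" "2 * n + 3 < m"
    and small: "\<And>u. u < n \<Longrightarrow> t u < 2 ^ B" "\<And>v s. v < n \<Longrightarrow> s \<le> 2 * n \<Longrightarrow> S v s < 2 ^ B"
    and fl: "\<And>v. v \<noteq> d \<Longrightarrow> of_bool (v = orig) + inflow s0 s1 n t v = t v"
    and N: "\<And>s v. s < 2 * n \<Longrightarrow> v < n \<Longrightarrow> N (s + 3) v \<longleftrightarrow> hit s v"
    and T: "\<And>u b. u < n \<Longrightarrow> b < m \<Longrightarrow> T u b \<longleftrightarrow> odd (t u div 2 ^ b)"
    and Q: "\<And>v s b. v < n \<Longrightarrow> s \<le> 2 * n \<Longrightarrow> b < m \<Longrightarrow> Q v s b \<longleftrightarrow> odd (S v s div 2 ^ b)"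
    and C: "\<And>v s b. v < n \<Longrightarrow> s < 2 * n \<Longrightarrow> b < m \<Longrightarrow> C v s b \<longleftrightarrow>
      carry (S v s) (if hit s v then t (src s) div 2 else 0) (hit s v \<and> s < n \<and> odd (t s)) b"
  shows "flow_ok m n (2 * n) orig d 0 N T Q C"
proof -
  have src: "src s < n" "s = src s \<or> src s + n = s" if "s < 2 * n" for s
    using that by (auto simp: src_def)
  have half: "t u div 2 ^ Suc b = t u div 2 div 2 ^ b" for u b
    by (simp add: div_mult2_eq)
  have SS: "S v (Suc s) = S v s + (if hit s v then t (src s) div 2 else 0) + of_bool (hit s v \<and> s < n \<and> odd (t s))"
    for v s
    by (auto simp: S_def edge_flow_def hit_def src_def elim!: evenE oddE)
  have A: "N (s + 3) v \<and> T (src s) (Suc b) \<longleftrightarrow> odd ((if hit s v then t (src s) div 2 else 0) div 2 ^ b)"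
    if "v < n" "s < 2 * n" "Suc b < m" for v s b
    using N[OF that(2,1)] T[OF src(1)[OF that(2)] that(3)] unfolding half by auto
  have 1: "Q v 0 b \<longleftrightarrow> b = 0 \<and> v = orig" if "v < n" "b < m" for v b
    using Q[OF that(1) _ that(2), of 0] by (cases b) (auto simp: S_def div_mult2_eq)
  have 2: "\<not> T u b" if "u < n" "m = Suc b" for u b
    using T[OF that(1), of b] small(1)[OF that(1)] that m by simp
  have 3: "C v s 0 \<longleftrightarrow> N (s + 3) v \<and> s < n \<and> T (src s) 0" if "v < n" "s < 2 * n" for v s
    using C[OF that, of 0] N[OF that(2,1)] T[OF src(1)[OF that(2)], of 0] m
    by (auto simp: src_def)
  have 4: "\<not> C v s b" if "v < n" "s < 2 * n" "m = Suc b" for v s b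
  proof -
    have "S v (Suc s) < 2 ^ b" using small(2)[of v "Suc s"] that m by simp
    then show ?thesis using C[OF that(1,2), of b] that(3) carry_top unfolding SS by simp
  qed
  have 5: "Q v (Suc s) b \<longleftrightarrow> ((Q v s b \<longleftrightarrow> N (s + 3) v \<and> T (src s) (Suc b)) \<longleftrightarrow> C v s b)"
    if "v < n" "s < 2 * n" "Suc b < m" for v s b
    unfolding A[OF that] using that
    by (simp add: Q C SS carry_bit del: of_bool_conj)
  have 6: "C v s (Suc b) \<longleftrightarrow> Q v s b \<and> N (s + 3) v \<and> T (src s) (Suc b)
       \<or> C v s b \<and> (Q v s b \<or> N (s + 3) v \<and> T (src s) (Suc b))"
    if "v < n" "s < 2 * n" "Suc b < m" for v s b
    unfolding A[OF that] using that by (simp add: Q C)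
  have 7: "Q v (2 * n) b \<longleftrightarrow> T v b" if "v < n" "v \<noteq> d" "b < m" for v b
    using Q[OF that(1) _ that(3), of "2 * n"] T[OF that(1,3)] fl[OF that(2)]
    by (simp add: S_def sum_edge_flow)
  have step: "\<exists>u<n. \<exists>j<m. \<exists>i<m. j = s + 3 \<and> i = Suc s \<and> (s = u \<or> u + n = s) \<and>
      (C v s 0 \<longleftrightarrow> N j v \<and> s < n \<and> T u 0) \<and>
      (\<forall>b<m. m = Suc b \<longrightarrow> \<not> C v s b) \<and>
      (\<forall>b<m. \<forall>c<m. c = Suc b \<longrightarrow>
        (Q v i b \<longleftrightarrow> ((Q v s b \<longleftrightarrow> N j v \<and> T u c) \<longleftrightarrow> C v s b)) \<and>
        (C v s c \<longleftrightarrow> Q v s b \<and> N j v \<and> T u c \<or> C v s b \<and> (Q v s b \<or> N j v \<and> T u c)))"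
    if "v < n" "s < 2 * n" for v s
    by (rule exI[of _ "src s"], rule conjI[OF src(1)[OF that(2)]], rule exI[of _ "s + 3"],
        rule conjI, use m that in simp, rule exI[of _ "Suc s"], rule conjI, use m that in simp)
      (use src(2)[OF that(2)] 3[OF that] 4[OF that] 5[OF that] 6[OF that] in blast)
  show ?thesis
    unfolding flow_ok_def using 1 2 step 7 by blast
qed

section \<open>Soundness and completeness of the certificate\<close>

lemma verifier_input_word: "word (verifier_input x y)" "set (verifier_input x y) \<subseteq> {..<4}"
  by (auto simp: word_def verifier_input_def sym_def split: if_splits)

text \<open>The letters of \<open>x\<close> and \<open>y\<close> are 1 or 2, so the position guessed
  in \<open>cert_ok\<close> is forced to be the end of \<open>x\<close>, whatever \<open>y\<close>
  contains.\<close>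

lemma verifier_input_sep:
  "m < length (verifier_input x y) \<Longrightarrow> verifier_input x y ! m = 3 \<longleftrightarrow> m = length x"
  by (auto simp: verifier_input_def nth_append nth_Cons sym_def split: nat.splits if_splits)

lemma verifier_input_nth: "p < length x \<Longrightarrow> verifier_input x y ! p = 2 \<longleftrightarrow> x ! p"
  by (auto simp: verifier_input_def nth_append sym_def)

lemma cert_sound:
  assumes "cert_ok (verifier_input x y)"
  shows "x \<in> ARRIVAL"
proof -
  define w where "w = verifier_input x y"
  define m where "m = length x"
  have ex: "\<exists>n<m. \<exists>orig<n. \<exists>d<n. 2 * n + 3 < m \<and>
     table w m 1 0 n 0 \<and> table w m 1 1 orig 0 \<and> table w m 1 2 d 0 \<and> table w m 0 0 0 n \<and>
     (\<forall>j<2 * n + 3. \<forall>v<m. \<forall>u<m. table w m 1 j v 0 \<and> table w m 1 j u 0 \<longrightarrow> v = u) \<and>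
     (\<forall>j<2 * n + 3. 2 < j \<longrightarrow> (\<exists>v<n. table w m 1 j v 0)) \<and>
     parse_ok m (2 * n + 3) (\<lambda>p. w ! p = 2) (table w m 0) (\<lambda>j v. table w m 1 j v 0) \<and>
     flow_ok m n (2 * n) orig d 0 (\<lambda>j v. table w m 1 j v 0) (\<lambda>u b. table w m 2 u b 0)
       (table w m 3) (table w m 4)"
    using assms unfolding cert_ok_def w_def[symmetric]
    apply (elim exE conjE)
    apply (simp only: verifier_input_sep w_def)
    apply (simp only: w_def[symmetric] m_def[symmetric])
    apply hypsubst
    apply blast
    done
  then obtain n orig d where n: "n < m" "2 * n + 3 < m" and od: "orig < n" "d < n"
    and N: "table w m 1 0 n 0" "table w m 1 1 orig 0" "table w m 1 2 d 0" and P: "table w m 0 0 0 n"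
    and fn: "\<And>j v u. j < 2 * n + 3 \<Longrightarrow> v < m \<Longrightarrow> u < m \<Longrightarrow> table w m 1 j v 0 \<Longrightarrow> table w m 1 j u 0 \<Longrightarrow> v = u"
    and ent: "\<And>j. j < 2 * n + 3 \<Longrightarrow> 2 < j \<Longrightarrow> \<exists>v<n. table w m 1 j v 0"
    and parse: "parse_ok m (2 * n + 3) (\<lambda>p. w ! p = 2) (table w m 0) (\<lambda>j v. table w m 1 j v 0)"
    and flow: "flow_ok m n (2 * n) orig d 0 (\<lambda>j v. table w m 1 j v 0) (\<lambda>u b. table w m 2 u b 0)
       (table w m 3) (table w m 4)"
    by blast
  define nm where "nm j = (THE v. v < m \<and> table w m 1 j v 0)" for j
  have nm: "nm j = v" if "j < 2 * n + 3" "v < m" "table w m 1 j v 0" for j v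
    unfolding nm_def by (rule the_equality) (use that fn in blast)+
  define s0 where "s0 = map nm [3..<3 + n]"
  define s1 where "s1 = map nm [3 + n..<3 + n + n]"
  have "drop 0 x = enc_num n @ concat (map enc_num (map nm [Suc 0..<2 * n + 3]))"
  proof (rule parse_sound[OF parse[unfolded m_def]])
    show "w ! p = 2 \<longleftrightarrow> x ! p" if "p < length x" for p
      using that by (simp add: w_def verifier_input_nth)
    show "nm i = u" if "i < 2 * n + 3" "u < length x" "table w (length x) 1 i u 0" for i u
      using nm that unfolding m_def by blast
    show "table w (length x) 0 0 0 n" using P unfolding m_def .
  qed (use n in \<open>auto simp: m_def\<close>)
  moreover have "nm 0 = n" "nm 1 = orig" "nm 2 = d"
    by (rule nm[OF _ _ N(1)] nm[OF _ _ N(2)] nm[OF _ _ N(3)], use n od in simp, use n od in simp)+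
  moreover have "[Suc 0..<2 * n + 3] = [1, 2] @ [3..<3 + n] @ [3 + n..<3 + n + n]"
  proof -
    have "[Suc 0..<2 * n + 3] = Suc 0 # Suc (Suc 0) # [Suc (Suc (Suc 0))..<2 * n + 3]"
      by (subst upt_conv_Cons, simp, subst upt_conv_Cons, simp_all)
    moreover have "[3..<3 + n + n] = [3..<3 + n] @ [3 + n..<3 + n + n]"
      by (rule upt_add_eq_append) simp
    moreover have "3 + n + n = 2 * n + 3" "Suc (Suc (Suc 0)) = 3" "Suc (Suc 0) = 2" by simp_all
    ultimately show ?thesis by simp
  qed
  ultimately have x: "x = enc_instance n s0 s1 orig d"
    unfolding enc_instance_def s0_def s1_def by simp
  have e: "nm (u + 3) < n \<and> table w m 1 (u + 3) (nm (u + 3)) 0" if u: "u < 2 * n" for u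
  proof -
    obtain v where "v < n" "table w m 1 (u + 3) v 0" using ent[of "u + 3"] u by auto
    moreover from this have "nm (u + 3) = v" using nm[of "u + 3" v] u n by simp
    ultimately show ?thesis by simp
  qed
  have s0: "s0 ! u = nm (u + 3)" "s1 ! u = nm (u + n + 3)" if "u < n" for u
    using that by (simp_all add: s0_def s1_def ac_simps)
  have inst: "valid_instance n s0 s1 orig d"
    using e s0 od by (auto simp: valid_instance_def s0_def s1_def)
  then interpret switch_graph n s0 s1 orig d by unfold_locales
  have "run_terminates s0 s1 orig d"
  proof (rule flow_imp_terminates)
    fix v assume v: "v < n" "v \<noteq> d"
    have N': "table w m 1 (u + 3) v 0 \<longleftrightarrow> nm (u + 3) = v" if "u < 2 * n" "v < n" for u v
      using e[OF that(1)] nm[of "u + 3" v] that n by auto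
    show "of_bool (v = orig) + inflow s0 s1 n (\<lambda>u. val m (\<lambda>b. table w m 2 u b 0)) v
        = val m (\<lambda>b. table w m 2 v b 0)"
      by (rule flow_sound[OF flow, where B = "m - 1"]) (use n v N' s0 in auto)
  qed
  then show ?thesis unfolding ARRIVAL_def using x inst by blast
qed

text \<open>The base-\<open>m\<close> digits of an address recover \<open>r\<close>,
  \<open>i\<close>, \<open>j\<close>, \<open>l\<close>, so all entries can be prescribed freely. The
  string depends on \<open>m\<close> and \<open>R\<close> only, not on the input word.\<close>

lemma ex_table:
  fixes R :: "nat \<Rightarrow> nat \<Rightarrow> nat \<Rightarrow> nat \<Rightarrow> bool"
  obtains y where "length y = 5 * m ^ 3"
    "\<And>x r i j l. length x = m \<Longrightarrow> r < 5 \<Longrightarrow> i < m \<Longrightarrow> j < m \<Longrightarrow> l < m \<Longrightarrow>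
       table (verifier_input x y) m r i j l \<longleftrightarrow> R r i j l"
proof -
  define y where "y = map (\<lambda>q. R (q div m div m div m) (q div m div m mod m) (q div m mod m) (q mod m)) [0..<5 * m ^ 3]"
  have y: "length y = 5 * m ^ 3" by (simp add: y_def)
  have "table (verifier_input x y) m r i j l \<longleftrightarrow> R r i j l"
    if x: "length x = m" and r: "r < 5" and b: "i < m" "j < m" "l < m"
    for x :: "bool list" and r i j l :: nat
  proof -
    define a where "a = r * m + i"
    define c where "c = a * m + j"
    define q where "q = c * m + l"
    have aa: "a < 5 * m"
    proof -
      have "a < r * m + m" using b by (simp add: a_def)
      also have "\<dots> = (r + 1) * m" by simp
      also have "\<dots> \<le> 5 * m" by (rule mult_le_mono1) (use r in simp)
      finally show ?thesis .
    qed
    have cc: "c < 5 * m * m"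
    proof -
      have "c < a * m + m" using b by (simp add: c_def)
      also have "\<dots> = (a + 1) * m" by simp
      also have "\<dots> \<le> 5 * m * m" by (rule mult_le_mono1) (use aa in simp)
      finally show ?thesis .
    qed
    have qq: "q < 5 * m ^ 3"
    proof -
      have "q < c * m + m" using b by (simp add: q_def)
      also have "\<dots> = (c + 1) * m" by simp
      also have "\<dots> \<le> 5 * m * m * m" by (rule mult_le_mono1) (use cc in simp)
      finally show ?thesis by (simp add: power3_eq_cube mult.assoc)
    qed
    have "y ! q = R r i j l"
      using qq b by (simp add: y_def) (simp add: q_def c_def a_def)
    moreover have "verifier_input x y ! Suc (m + q) = sym (y ! q)"
      using qq x y by (simp add: verifier_input_def nth_append)
    moreover have "length (verifier_input x y) = Suc (m + 5 * m ^ 3)"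
      using x y by (simp add: verifier_input_def)
    moreover have "r < Suc (m + 5 * m ^ 3)"
    proof -
      have "1 \<le> m ^ 3" using b by simp
      then show ?thesis using r by linarith
    qed
    ultimately show ?thesis
      unfolding table_def Let_def a_def[symmetric] c_def[symmetric] q_def[symmetric]
      using qq by (simp add: sym_def)
  qed
  then show thesis using that y by blast
qed

lemma length_enc_num: "2 \<le> length (enc_num v)"
  by (simp add: enc_num_def)

lemma cert_complete:
  assumes "x \<in> ARRIVAL"
  obtains y where "length y = 5 * length x ^ 3" "cert_ok (verifier_input x y)"
proof -
  obtain n s0 s1 orig d where x: "x = enc_instance n s0 s1 orig d"
    and inst: "valid_instance n s0 s1 orig d" and ends: "run_terminates s0 s1 orig d"
    using assms by (auto simp: ARRIVAL_def)
  interpret switch_graph n s0 s1 orig d using inst by unfold_locales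
  obtain t where fl: "\<And>v. v \<noteq> d \<Longrightarrow> of_bool (v = orig) + inflow s0 s1 n t v = t v"
    and tb: "(\<Sum>v<n. t v) < n * 2 ^ n"
    using terminates_imp_flow[OF ends] by blast
  define L where "L = [n, orig, d] @ s0 @ s1"
  define m where "m = length x"
  define J where "J = 2 * n + 3"
  have lens: "length s0 = n" "length s1 = n" and od: "orig < n" "d < n"
    and ent: "\<And>v. v < n \<Longrightarrow> s0 ! v < n" "\<And>v. v < n \<Longrightarrow> s1 ! v < n"
    using inst by (auto simp: valid_instance_def)
  have xL: "x = concat (map enc_num L)" by (simp add: x enc_instance_def L_def)
  have JL: "J = length L" using lens by (simp add: J_def L_def)
  have "2 * length K \<le> length (concat (map enc_num K))" for K
  proof (induction K)
    case (Cons a K)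
    then show ?case using length_enc_num[of a] by simp
  qed simp
  \<comment> \<open>The end marker alone gives each of the 2 * n + 3 numbers two letters; all later
    size comparisons with \<open>m\<close> rest on this bound.\<close>
  from this[of L] have m: "4 * n + 6 \<le> m" unfolding m_def xL[symmetric] JL[symmetric] J_def by simp
  obtain B where B: "m = Suc B" using m by (cases m) auto
  have nth: "L ! 0 = n" "L ! 1 = orig" "L ! 2 = d" by (simp_all add: L_def)
  have Ls: "L ! (s + 3) = (if s < n then s0 ! s else s1 ! (s - n))" for s
    using lens by (simp add: L_def nth_append numeral_3_eq_3)
  \<comment> \<open>The numbers of a valid instance are at most \<open>n\<close>, so they can be
    values of variables below \<open>m\<close>.\<close>
  have Lm: "L ! i < m" if "i < J" for i
  proof -
    have "v \<le> n" if "v \<in> set s0 \<union> set s1" for v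
      using that ent lens by (auto simp: in_set_conv_nth less_imp_le)
    then have "\<forall>v\<in>set L. v \<le> n" using od by (auto simp: L_def)
    moreover have "L ! i \<in> set L" using that JL by simp
    ultimately have "L ! i \<le> n" by blast
    then show ?thesis using m by simp
  qed
  define S where "S v s = of_bool (v = orig) + (\<Sum>s'<s. edge_flow s0 s1 n t v s')" for v s
  define src where "src s = (if s < n then s else s - n)" for s
  define hit where "hit s v \<longleftrightarrow> (if s < n then s0 ! s else s1 ! (s - n)) = v" for s v
  define R where "R r i j l =
    (if r = 0 then j < J \<and> drop i x = enc_num l @ concat (map enc_num (drop (Suc j) L))
     else if r = 1 then i < J \<and> j = L ! i
     else if r = 2 then odd (t i div 2 ^ j)
     else if r = 3 then odd (S i j div 2 ^ l)
     else carry (S i j) (if hit j i then t (src j) div 2 else 0) (hit j i \<and> j < n \<and> odd (t j)) l)"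
    for r i j l :: nat
  obtain y where y: "length y = 5 * m ^ 3"
    and tab: "\<And>x r i j l. length x = m \<Longrightarrow> r < 5 \<Longrightarrow> i < m \<Longrightarrow> j < m \<Longrightarrow> l < m \<Longrightarrow>
       table (verifier_input x y) m r i j l \<longleftrightarrow> R r i j l"
    using ex_table by blast
  define w where "w = verifier_input x y"
  have tab: "table w m r i j l \<longleftrightarrow> R r i j l" if "r < 5" "i < m" "j < m" "l < m" for r i j l
    unfolding w_def using tab[OF m_def[symmetric] that] .
  have pow: "n * 2 ^ n \<le> 2 ^ B"
  proof -
    have "n * 2 ^ n \<le> 2 ^ n * 2 ^ n" by (rule mult_le_mono1) (simp add: less_imp_le)
    also have "\<dots> = (2::nat) ^ (n + n)" by (simp add: power_add)
    also have "\<dots> \<le> 2 ^ B" by (rule power_increasing) (use m B in auto)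
    finally show ?thesis .
  qed
  have tB: "t u < 2 ^ B" if "u < n" for u
  proof -
    have "t u \<le> (\<Sum>v<n. t v)" using that by (intro member_le_sum) auto
    then show ?thesis using tb pow by linarith
  qed
  have SB: "S v s < 2 ^ B" if "s \<le> 2 * n" for v s
  proof -
    have "(\<Sum>s'<s. edge_flow s0 s1 n t v s') \<le> (\<Sum>s'<2 * n. edge_flow s0 s1 n t v s')"
      by (rule sum_mono2) (use that in auto)
    also have "\<dots> = inflow s0 s1 n t v" by (rule sum_edge_flow)
    \<comment> \<open>Ceiling and floor of \<open>t u / 2\<close> add up to \<open>t u\<close>, even
      if both edges of \<open>u\<close> lead to \<open>v\<close>.\<close>
    also have "\<dots> \<le> (\<Sum>u<n. t u)"
      unfolding inflow_def sum.distrib[symmetric] by (rule sum_mono) auto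
    finally have a: "S v s \<le> of_bool (v = orig) + (\<Sum>u<n. t u)" by (simp add: S_def)
    \<comment> \<open>The token at \<open>orig\<close> can raise the sum to \<open>n * 2 ^ n\<close>
      itself, so \<open>pow\<close> has to be sharpened to a strict bound.\<close>
    have "n * 2 ^ n < (2::nat) ^ B"
    proof -
      have "n * 2 ^ n < 2 ^ n * (2::nat) ^ n" by simp
      also have "\<dots> = (2::nat) ^ (n + n)" by (simp add: power_add)
      also have "\<dots> \<le> 2 ^ B" by (rule power_increasing) (use m B in auto)
      finally show ?thesis .
    qed
    then show ?thesis using a tb by (cases "v = orig") auto
  qed
  have tab0: "table w m 0 i j l \<longleftrightarrow> j < J \<and> drop i x = enc_num l @ concat (map enc_num (drop (Suc j) L))"
    and tab1: "table w m 1 i j l \<longleftrightarrow> i < J \<and> j = L ! i"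
    and tab2: "table w m 2 i j l \<longleftrightarrow> odd (t i div 2 ^ j)"
    and tab3: "table w m 3 i j l \<longleftrightarrow> odd (S i j div 2 ^ l)"
    and tab4: "table w m 4 i j l \<longleftrightarrow>
      carry (S i j) (if hit j i then t (src j) div 2 else 0) (hit j i \<and> j < n \<and> odd (t j)) l"
    if "i < m" "j < m" "l < m" for i j l
    using tab[of _ i j l, OF _ that] by (simp_all add: R_def del: One_nat_def)
  have m0: "0 < m" using m by simp
  have parse: "parse_ok m J (\<lambda>p. w ! p = 2) (table w m 0) (\<lambda>j v. table w m 1 j v 0)"
    unfolding m_def
  proof (rule parse_complete[OF xL])
    show "w ! p = 2 \<longleftrightarrow> x ! p" if "p < length x" for p
      using that by (simp add: w_def verifier_input_nth)
    show "L ! i < length x" if "i < length L" for i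
      using Lm JL that by (simp add: m_def)
    show "table w (length x) 1 j v 0 \<longleftrightarrow> j < J \<and> v = L ! j" if "j < length x" "v < length x" for j v
      using tab1[of j v 0] that m0 unfolding m_def by auto
    show "table w (length x) 0 p j v \<longleftrightarrow> j < J \<and> drop p x = enc_num v @ concat (map enc_num (drop (Suc j) L))"
      if "p < length x" "j < length x" "v < length x" for p j v
      using tab0[of p j v] that unfolding m_def by simp
  qed (use JL m in \<open>simp_all add: m_def J_def\<close>)
  have flow: "flow_ok m n (2 * n) orig d 0 (\<lambda>j v. table w m 1 j v 0) (\<lambda>u b. table w m 2 u b 0)
       (table w m 3) (table w m 4)"
  proof (rule flow_complete[where t = t and n = n and orig = orig and ?s0.0 = s0 and ?s1.0 = s1 and B = B, OF B, folded S_def src_def hit_def])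
    show "2 * n + 3 < m" using m by simp
    show "t u < 2 ^ B" if "u < n" for u using tB[OF that] .
    show "S v s < 2 ^ B" if "v < n" "s \<le> 2 * n" for v s using SB[OF that(2)] .
    show "of_bool (v = orig) + inflow s0 s1 n t v = t v" if "v \<noteq> d" for v using fl[OF that] .
    show "table w m 1 (s + 3) v 0 \<longleftrightarrow> hit s v" if "s < 2 * n" "v < n" for s v
      using tab1[of "s + 3" v 0] that m Ls[of s] by (auto simp: hit_def J_def)
    show "table w m 2 u b 0 \<longleftrightarrow> odd (t u div 2 ^ b)" if "u < n" "b < m" for u b
      using tab2[of u b 0] that m by simp
    show "table w m 3 v s b \<longleftrightarrow> odd (S v s div 2 ^ b)" if "v < n" "s \<le> 2 * n" "b < m" for v s b
      using tab3[of v s b] that m by simp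
    show "table w m 4 v s b \<longleftrightarrow>
        carry (S v s) (if hit s v then t (src s) div 2 else 0) (hit s v \<and> s < n \<and> odd (t s)) b"
      if "v < n" "s < 2 * n" "b < m" for v s b
      using tab4[of v s b] that m by simp
  qed
  have facts: "table w m 1 0 n 0" "table w m 1 1 orig 0" "table w m 1 2 d 0" "table w m 0 0 0 n"
    using m od nth JL xL tab1[of 0 n 0] tab1[of 1 orig 0] tab1[of 2 d 0] tab0[of 0 0 n]
    by (simp_all add: J_def L_def)
  have fn: "\<forall>j<J. \<forall>v<m. \<forall>u<m. table w m 1 j v 0 \<and> table w m 1 j u 0 \<longrightarrow> v = u"
  proof (intro allI impI)
    fix j v u
    assume "j < J" "v < m" "u < m" "table w m 1 j v 0 \<and> table w m 1 j u 0"
    then show "v = u" using tab1[of j v 0] tab1[of j u 0] m by (simp add: J_def)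
  qed
  have en: "\<forall>j<J. 2 < j \<longrightarrow> (\<exists>v<n. table w m 1 j v 0)"
  proof (intro allI impI)
    fix j assume j: "j < J" "2 < j"
    then obtain s where s: "j = s + 3" using le_Suc_ex[of 3 j] by (auto simp: add.commute)
    then have "L ! j < n" using j ent Ls[of s] by (auto simp: J_def)
    moreover have "table w m 1 j (L ! j) 0"
      using tab1[of j "L ! j" 0] j m Lm[OF j(1)] by (simp add: J_def)
    ultimately show "\<exists>v<n. table w m 1 j v 0" by blast
  qed
  have mw: "m < length w" "w ! m = 3"
    by (simp_all add: w_def m_def verifier_input_def nth_append)
  have "cert_ok w"
    unfolding cert_ok_def
    apply (rule exI[of _ m], intro conjI mw)
    apply (rule exI[of _ n], rule conjI, use m in simp)
    apply (rule exI[of _ orig], intro conjI od)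
    apply (rule exI[of _ d], intro conjI od)
    apply (rule exI[of _ "2 * n"], rule conjI, use m in simp)
    apply (rule exI[of _ J], rule conjI, use m in \<open>simp add: J_def\<close>)
    apply (rule exI[of _ 0], rule conjI, use m in simp)
    apply (rule exI[of _ 1], rule conjI, use m in simp)
    apply (rule exI[of _ 2], rule conjI, use m in simp)
    apply (intro conjI refl facts fn en parse flow)
    apply (simp add: J_def)
    done
  then show thesis using that y unfolding w_def m_def by blast
qed

section \<open>Polynomial bounds and membership in NP\<close>

theorem theorem2:
  shows "in_NP ARRIVAL"
proof -
  obtain M f where M: "wf_tm M" "pbound f"
    and acc: "\<And>w. word w \<Longrightarrow> set w \<subseteq> {..<4} \<Longrightarrow> cert_ok w \<Longrightarrow> accepts_within M w (f (length w))"
      "\<And>w t. word w \<Longrightarrow> set w \<subseteq> {..<4} \<Longrightarrow> accepts_within M w t \<Longrightarrow> cert_ok w"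
    using dec_tm[OF dec_cert_ok] by blast
  obtain b where b: "\<And>n. f n \<le> (n + 2) ^ b" using M(2) unfolding pbound_def by blast
  \<comment> \<open>For \<open>m > 0\<close> the length of the verifier input plus 2 is
    \<open>m + 5 * m ^ 3 + 3\<close>, at most \<open>9 * m ^ 3\<close>; this gives
    \<open>9 ^ b\<close> and the exponent \<open>3 * b\<close>. The summands 5 and 3 cover the
    certificate length \<open>5 * m ^ 3\<close>, and the additive \<open>c\<close> covers
    \<open>m = 0\<close>.\<close>
  define c where "c = 9 ^ b + (5 :: nat)"
  define k where "k = 3 * b + 3"
  have le: "5 * m ^ 3 \<le> c * m ^ k + c" "f (Suc (m + 5 * m ^ 3)) \<le> c * m ^ k + c" for m
  proof -
    show "f (Suc (m + 5 * m ^ 3)) \<le> c * m ^ k + c"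
    proof (cases "m = 0")
      case True
      have "f 1 \<le> 3 ^ b" using b[of 1] by (simp add: numeral_3_eq_3)
      also have "\<dots> \<le> 9 ^ b" by (rule power_mono) auto
      finally show ?thesis using True by (simp add: c_def k_def)
    next
      case False
      have "f (Suc (m + 5 * m ^ 3)) \<le> (Suc (m + 5 * m ^ 3) + 2) ^ b" by (rule b)
      also have "\<dots> \<le> (9 * m ^ 3) ^ b"
      proof (rule power_mono)
        have "m \<le> m ^ 3" "1 \<le> m ^ 3" using False by (simp_all add: self_le_power)
        then show "Suc (m + 5 * m ^ 3) + 2 \<le> 9 * m ^ 3" by linarith
      qed simp
      also have "\<dots> = 9 ^ b * m ^ (3 * b)" by (simp add: power_mult_distrib power_mult)
      also have "\<dots> \<le> c * m ^ k"
        by (intro mult_le_mono power_increasing) (use False in \<open>auto simp: c_def k_def\<close>)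
      finally show ?thesis by simp
    qed
    show "5 * m ^ 3 \<le> c * m ^ k + c"
    proof (cases "m = 0")
      case False
      have "5 * m ^ 3 \<le> c * m ^ k"
        by (intro mult_le_mono power_increasing) (use False in \<open>auto simp: c_def k_def\<close>)
      then show ?thesis by simp
    qed simp
  qed
  have "x \<in> ARRIVAL \<longleftrightarrow> (\<exists>y. length y \<le> c * length x ^ k + c \<and>
      accepts_within M (verifier_input x y) (c * length x ^ k + c))" for x
  proof
    assume "x \<in> ARRIVAL"
    then obtain y where y: "length y = 5 * length x ^ 3" "cert_ok (verifier_input x y)"
      by (rule cert_complete)
    have "length (verifier_input x y) = Suc (length x + 5 * length x ^ 3)"
      using y(1) by (simp add: verifier_input_def)
    with acc(1)[OF verifier_input_word y(2)]
    have "accepts_within M (verifier_input x y) (f (Suc (length x + 5 * length x ^ 3)))" by simp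
    then have "accepts_within M (verifier_input x y) (c * length x ^ k + c)"
      using le(2)[of "length x"] unfolding accepts_within_def by (meson le_trans)
    then show "\<exists>y. length y \<le> c * length x ^ k + c \<and>
        accepts_within M (verifier_input x y) (c * length x ^ k + c)"
      using y(1) le(1) by metis
  next
    assume "\<exists>y. length y \<le> c * length x ^ k + c \<and>
        accepts_within M (verifier_input x y) (c * length x ^ k + c)"
    then show "x \<in> ARRIVAL" using acc(2)[OF verifier_input_word] cert_sound by blast
  qed
  with M(1) show ?thesis unfolding in_NP_def by blast
qed

end
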